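(* Let $p,q\ge 1$ be integers with $n=p+q\ge 3$. For every $\delta>0$ and for almost every (with respect to Lebesgue measure) real quadratic form $Q$ in $n$ variables of signature $(p,q)$, there are constants $c_Q>0$ and $\epsilon_0>0$ such that for every $0<\epsilon<\epsilon_0$ there exists a nonzero $x\in\mathbb{Z}^n$ with $$\|x\|\le c_Q\,\epsilon^{-\left(\frac{1}{n-2}+\delta\right)}\quad\text{and}\quad |Q(x)|<\epsilon.$$
   Context: Quadratic forms in $n$ variables are identified with real symmetric $n\times n$ matrices; those of signature $(p,q)$ form an open subset of this finite-dimensional real vector space, and "almost every" refers to Lebesgue measure on it. $\|\cdot\|$ is the Euclidean norm on $\mathbb{R}^n$. *)

theory Defs
  imports "HOL-Analysis.Analysis"
begin

definition sym_matrices :: "(real ^ 'n ^ 'n) set" where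
  "sym_matrices = {Q. transpose Q = Q}"

definition quad_form :: "real ^ 'n ^ 'n \<Rightarrow> real ^ 'n \<Rightarrow> real" where
  "quad_form Q x = x \<bullet> (Q *v x)"

text \<open>Signature of a quadratic form (Sylvester): in a suitable basis, the columns of \<open>P\<close>, the form
  is diagonal with \<open>p\<close> positive and \<open>q\<close> negative coefficients.\<close>
definition has_signature :: "nat \<Rightarrow> nat \<Rightarrow> real ^ 'n ^ 'n \<Rightarrow> bool" where
  "has_signature p q Q \<longleftrightarrow>
     Q \<in> sym_matrices \<and>
     (\<exists>(P :: real ^ 'n ^ 'n) (d :: 'n \<Rightarrow> real). invertible P \<and>
        transpose P ** Q ** P = (\<chi> i j. if i = j then d i else 0) \<and>
        card {i. d i > 0} = p \<and> card {i. d i < 0} = q)"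

text \<open>A symmetric matrix is determined by one real coordinate for each unordered pair \<open>{i, j}\<close>
  of indices, where \<open>i = j\<close> is allowed; this is a linear isomorphism from
  \<open>n (n + 1) / 2\<close>-dimensional Euclidean space onto the space of symmetric matrices.\<close>
definition index_pairs :: "'n set set" where
  "index_pairs = {{i, j} | i j. True}"

definition sym_matrix_of :: "('n set \<Rightarrow> real) \<Rightarrow> real ^ 'n ^ 'n" where
  "sym_matrix_of a = (\<chi> i j. a {i, j})"

text \<open>Lebesgue measure on the vector space of symmetric matrices (on its Borel sets), transported
  along these coordinates. Another choice of linear coordinates only rescales it by a positive
  constant. As a measure on the whole matrix space it would be singular, so that
  \<^term>\<open>lebesgue\<close> on \<^typ>\<open>real ^ 'n ^ 'n\<close> cannot be used here.\<close>
definition sym_lebesgue :: "(real ^ 'n ^ 'n) measure" where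
  "sym_lebesgue =
     distr (\<Pi>\<^sub>M s\<in>index_pairs. lborel) (restrict_space borel sym_matrices) sym_matrix_of"

text \<open>The push-forward \<^const>\<open>distr\<close> is meaningful only along a measurable map.\<close>
lemma sym_matrix_of_measurable:
  "sym_matrix_of \<in> measurable (\<Pi>\<^sub>M s\<in>(index_pairs :: 'n::finite set set). lborel)
     (restrict_space borel (sym_matrices :: (real ^ 'n ^ 'n) set))"
proof (rule measurable_restrict_space2)
  show "sym_matrix_of \<in> space (\<Pi>\<^sub>M s\<in>(index_pairs :: 'n set set). lborel) \<rightarrow> sym_matrices"
    by (auto simp: sym_matrix_of_def sym_matrices_def transpose_def insert_commute)
  have "(\<lambda>a. sym_matrix_of a \<bullet> b) \<in> borel_measurable (\<Pi>\<^sub>M s\<in>(index_pairs :: 'n set set). lborel)"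
    if "b \<in> Basis" for b :: "real ^ 'n ^ 'n"
  proof -
    have "\<exists>i j. b = axis i (axis j 1)"
      using that by (auto simp: Basis_vec_def)
    then obtain i j where b: "b = axis i (axis j 1)"
      by blast
    have "(\<lambda>a. sym_matrix_of a \<bullet> b) = (\<lambda>a. a {i, j})"
      by (simp add: b sym_matrix_of_def inner_axis)
    moreover have "{i, j} \<in> index_pairs"
      by (auto simp: index_pairs_def)
    ultimately show ?thesis
      using measurable_component_singleton[of "{i, j}" index_pairs "\<lambda>_. lborel"] by simp
  qed
  then show "sym_matrix_of \<in> borel_measurable (\<Pi>\<^sub>M s\<in>(index_pairs :: 'n set set). lborel)"
    using borel_measurable_euclidean_space by blast
qed

lemma sym_matrix_of_bij:
  "bij_betw sym_matrix_of (space (\<Pi>\<^sub>M s\<in>(index_pairs :: 'n::finite set set). lborel))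
     (sym_matrices :: (real ^ 'n ^ 'n) set)"
proof (rule bij_betwI')
  fix a b :: "'n set \<Rightarrow> real"
  assume "a \<in> space (\<Pi>\<^sub>M s\<in>(index_pairs :: 'n set set). lborel)"
    and "b \<in> space (\<Pi>\<^sub>M s\<in>(index_pairs :: 'n set set). lborel)"
  then have ab: "a \<in> extensional index_pairs" "b \<in> extensional index_pairs"
    by (auto simp: space_PiM PiE_def)
  show "(sym_matrix_of a = sym_matrix_of b) = (a = b)"
  proof
    assume "sym_matrix_of a = sym_matrix_of b"
    then have "a {i, j} = b {i, j}" for i j
      by (simp add: sym_matrix_of_def vec_eq_iff)
    then show "a = b"
      by (intro extensionalityI[OF ab]) (auto simp: index_pairs_def)
  qed simp
next
  fix a :: "'n set \<Rightarrow> real"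
  show "sym_matrix_of a \<in> sym_matrices"
    by (simp add: sym_matrix_of_def sym_matrices_def transpose_def insert_commute)
next
  fix Q :: "real ^ 'n ^ 'n"
  assume Q: "Q \<in> sym_matrices"
  then have sym: "Q $ i $ j = Q $ j $ i" for i j
    by (auto simp: sym_matrices_def transpose_def vec_eq_iff)
  define a where "a = restrict (\<lambda>s. THE r. \<exists>i j. s = {i, j} \<and> r = Q $ i $ j) index_pairs"
  have "a {i, j} = Q $ i $ j" for i j
  proof -
    have "(THE r. \<exists>k l. {i, j} = {k, l} \<and> r = Q $ k $ l) = Q $ i $ j"
      by (rule the_equality) (auto simp: doubleton_eq_iff sym)
    then show ?thesis
      by (auto simp: a_def index_pairs_def)
  qed
  then have "Q = sym_matrix_of a"
    by (simp add: sym_matrix_of_def vec_eq_iff)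
  moreover have "a \<in> space (\<Pi>\<^sub>M s\<in>(index_pairs :: 'n set set). lborel)"
    by (simp add: a_def space_PiM)
  ultimately show "\<exists>a\<in>space (\<Pi>\<^sub>M s\<in>(index_pairs :: 'n set set). lborel). Q = sym_matrix_of a"
    by blast
qed

end

theory Submission
  imports Defs "HOL-Probability.Probability"
begin

text \<open>Fix an index \<open>o'\<close> and complete the square: \<open>Q(x, m) = \<alpha> (x + s \<cdot> m)\<^sup>2 + G(m)\<close>, where \<open>\<alpha>\<close> is the
  diagonal entry, \<open>\<alpha> s\<close> the rest of its row, and \<open>x\<close> and \<open>m\<close> are the corresponding components of
  the integer point. The coordinate change from \<open>Q\<close> to \<open>(\<alpha>, s, G)\<close> is a scaling followed by a
  shear, so by Fubini it suffices to treat almost every \<open>s\<close> for fixed \<open>\<alpha>\<close> and \<open>G\<close>. When \<open>Q\<close> is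
  indefinite, \<open>-G(m)/\<alpha>\<close> is positive on an open cone of \<open>m\<close>; writing it as \<open>r(m)\<^sup>2\<close> there, it is enough
  that \<open>s \<cdot> m - r(m)\<close> lies within order \<open>\<epsilon>/M\<close> of an integer for some \<open>m\<close> of size about \<open>M\<close>. For
  non-parallel \<open>m, m'\<close> the pair \<open>(s \<cdot> m, s \<cdot> m')\<close> is exactly uniform on the 2-torus, so these events
  are pairwise independent apart from the few parallel pairs. Chebyshev's inequality bounds the
  probability that none of the \<open>M^(n-1)\<close> candidates works, up to a factor \<open>M\<close> to an arbitrarily
  small power, by \<open>1/(\<epsilon> M^(n-2))\<close>, which is summable over \<open>\<epsilon> = 1/2^k\<close> when
  \<open>M = \<epsilon> powr -(1/(n-2) + \<delta>)\<close>; Borel--Cantelli concludes.\<close>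

section \<open>Integer linear forms on the torus\<close>

text \<open>Haar measure of the circle, kept as a measure on the whole line: functions on the circle
  become 1-periodic functions of a real variable, and product spaces have the same points and
  measurable sets as those of \<open>lborel\<close>.\<close>

definition unif01 :: "real measure" where
  "unif01 = density lborel (indicator {0..<1})"

lemma sets_unif01 [simp, measurable_cong]: "sets unif01 = sets borel"
  by (simp add: unif01_def)

lemma space_unif01 [simp]: "space unif01 = UNIV"
  by (simp add: unif01_def)

lemma nn_integral_unif01:
  assumes [measurable]: "f \<in> borel_measurable borel"
  shows "(\<integral>\<^sup>+x. f x \<partial>unif01) = (\<integral>\<^sup>+x. indicator {0..<1} x * f x \<partial>lborel)"
  by (simp add: unif01_def nn_integral_density)

lemma prob_space_unif01: "prob_space unif01"
  by (rule prob_spaceI) (simp add: unif01_def emeasure_density)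

text \<open>The intervals [k, k + 1) tile the line; shifting each of them back to [0, 1) turns an
  integral over the line into a sum of integrals over the circle.\<close>

lemma nn_integral_lborel_tiles:
  assumes [measurable]: "f \<in> borel_measurable borel"
  shows "(\<integral>\<^sup>+x. f x \<partial>lborel) =
    (\<integral>\<^sup>+k. (\<integral>\<^sup>+x. f (x + of_int k) \<partial>unif01) \<partial>count_space (UNIV::int set))"
proof -
  have one: "(\<integral>\<^sup>+k. indicator {0..<1} (x - of_int k) \<partial>count_space (UNIV::int set)) = (1::ennreal)"
    for x :: real
  proof -
    have "indicator {0..<1} (x - of_int k) = (indicator {\<lfloor>x\<rfloor>} k :: ennreal)" for k
      by (auto simp: indicator_def intro: floor_unique[symmetric]) linarith+
    then show ?thesis
      by simp
  qed
  have "(\<integral>\<^sup>+x. f (x + of_int k) \<partial>unif01) =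
      (\<integral>\<^sup>+x. indicator {0..<1} (x - of_int k) * f x \<partial>lborel)" for k
    using nn_integral_real_affine[of "\<lambda>x. indicator {0..<1} (x - of_int k) * f x" 1 "of_int k"]
    by (simp add: nn_integral_unif01 add.commute)
  then have "(\<integral>\<^sup>+k. (\<integral>\<^sup>+x. f (x + of_int k) \<partial>unif01) \<partial>count_space (UNIV::int set)) =
      (\<integral>\<^sup>+x. (\<integral>\<^sup>+k. indicator {0..<1} (x - of_int k) * f x \<partial>count_space (UNIV::int set)) \<partial>lborel)"
    by (simp add: nn_integral_count_space_nn_integral)
  also have "\<dots> = (\<integral>\<^sup>+x. f x \<partial>lborel)"
    by (simp add: nn_integral_multc one)
  finally show ?thesis ..
qed

lemma periodic_of_int:
  fixes f :: "real \<Rightarrow> 'a"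
  assumes "\<And>x. f (x + 1) = f x"
  shows "f (x + of_int k) = f x"
proof (induction k rule: int_induct[where k=0])
  case (step1 i)
  then show ?case using assms[of "x + of_int i"] by (simp add: add.assoc)
next
  case (step2 i)
  then show ?case using assms[of "x + of_int (i - 1)"] by (simp add: add.assoc)
qed simp

lemma card_int_interval_scaled:
  fixes c :: int and y :: real
  assumes "c \<noteq> 0"
  shows "finite {k::int. (of_int k + y) / of_int c \<in> {0..<1}}"
    and "card {k::int. (of_int k + y) / of_int c \<in> {0..<1}} = nat \<bar>c\<bar>"
proof -
  \<comment> \<open>A negative \<open>c\<close> reverses the inequalities, so the closed end of the
    half-open interval moves to the right.\<close>
  have "{k::int. (of_int k + y) / of_int c \<in> {0..<1}} =
    (if c > 0 then {\<lceil>-y\<rceil>..<\<lceil>-y\<rceil> + c} else {\<lfloor>-y\<rfloor> + c<..\<lfloor>-y\<rfloor>})"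
    using assms by (auto simp: field_simps split: if_splits) linarith+
  then show "finite {k::int. (of_int k + y) / of_int c \<in> {0..<1}}"
    and "card {k::int. (of_int k + y) / of_int c \<in> {0..<1}} = nat \<bar>c\<bar>"
    using assms by auto
qed

text \<open>The map x -> t + c x wraps the unit interval |c| times around the circle. The Jacobian
  contributes the same factor |c|, written \<open>C\<close>, and cancels it.\<close>

lemma nn_integral_unif01_affine:
  fixes c :: int
  assumes [measurable]: "f \<in> borel_measurable borel"
    and per: "\<And>x. f (x + 1) = f x" and c: "c \<noteq> 0"
  shows "(\<integral>\<^sup>+x. f (t + of_int c * x) \<partial>unif01) = (\<integral>\<^sup>+x. f x \<partial>unif01)"
proof -
  define C where "C = ennreal \<bar>of_int c\<bar>"
  have C: "C \<noteq> 0" "C \<noteq> \<top>"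
    using c by (auto simp: C_def)
  \<comment> \<open>\<open>g\<close> is the indicator of the image of [0, 1) under the map; summed
    over integer translates it counts the |c| preimages of a point of the circle.\<close>
  define g :: "real \<Rightarrow> ennreal" where "g = (\<lambda>u. indicator {0..<1} ((u - t) / of_int c))"
  have [measurable]: "g \<in> borel_measurable borel"
    by (simp add: g_def)
  have count: "(\<integral>\<^sup>+k. g (u + of_int k) \<partial>count_space (UNIV::int set)) = C" for u
  proof -
    let ?S = "{k::int. (of_int k + (u - t)) / of_int c \<in> {0..<1}}"
    have "g (u + of_int k) = indicator ?S k" for k
      by (auto simp: g_def indicator_def algebra_simps)
    then have "(\<integral>\<^sup>+k. g (u + of_int k) \<partial>count_space (UNIV::int set)) = of_nat (card ?S)"
      using card_int_interval_scaled(1)[OF c, of "u - t"] by simp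
    then show ?thesis
      by (simp only: card_int_interval_scaled(2)[OF c])
         (simp add: C_def ennreal_of_nat_eq_real_of_nat)
  qed
  have "C * (\<integral>\<^sup>+x. f (t + of_int c * x) \<partial>unif01) = (\<integral>\<^sup>+u. g u * f u \<partial>lborel)"
    using nn_integral_real_affine[of "\<lambda>u. g u * f u" "of_int c" t] c
    by (simp add: nn_integral_unif01 g_def C_def)
  also have "\<dots> = (\<integral>\<^sup>+x. (\<integral>\<^sup>+k. g (x + of_int k) * f x \<partial>count_space (UNIV::int set)) \<partial>unif01)"
    by (simp add: nn_integral_lborel_tiles periodic_of_int[of f, OF per]
        nn_integral_count_space_nn_integral)
  also have "\<dots> = C * (\<integral>\<^sup>+x. f x \<partial>unif01)"
    by (simp add: nn_integral_multc count nn_integral_cmult)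
  finally show ?thesis
    using C by (simp add: ennreal_mult_cancel_left)
qed

interpretation U: product_sigma_finite "\<lambda>_. unif01"
  using prob_space_unif01 by (simp add: product_sigma_finite_def prob_space_imp_sigma_finite)

abbreviation pairing :: "'j set \<Rightarrow> ('j \<Rightarrow> real) \<Rightarrow> ('j \<Rightarrow> int) \<Rightarrow> real" where
  "pairing J s m \<equiv> (\<Sum>j\<in>J. s j * of_int (m j))"

text \<open>With all coordinates frozen except one where \<open>m j \<noteq> 0\<close>, the linear
  form is an affine map of the circle, so it is uniform mod 1.\<close>

lemma nn_integral_unif01_pairing:
  assumes J: "finite J" and [measurable]: "f \<in> borel_measurable borel"
    and per: "\<And>x. f (x + 1) = f x" and j: "j \<in> J" "m j \<noteq> 0"
  shows "(\<integral>\<^sup>+s. f (pairing J s m) \<partial>PiM J (\<lambda>_. unif01)) = (\<integral>\<^sup>+x. f x \<partial>unif01)"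
proof -
  define K where "K = J - {j}"
  have K: "J = insert j K" "j \<notin> K" "finite K"
    using j J by (auto simp: K_def)
  interpret PK: prob_space "PiM K (\<lambda>_. unif01)"
    by (intro prob_space_PiM prob_space_unif01)
  have upd: "pairing J (s(j := y)) m = pairing K s m + of_int (m j) * y" for s y
  proof -
    have "pairing K (s(j := y)) m = pairing K s m"
      using K by (intro sum.cong) auto
    then show ?thesis
      using K by (simp del: fun_upd_apply) simp
  qed
  have "(\<integral>\<^sup>+s. f (pairing J s m) \<partial>PiM J (\<lambda>_. unif01)) =
     (\<integral>\<^sup>+s. \<integral>\<^sup>+y. f (pairing J (s(j := y)) m) \<partial>unif01 \<partial>PiM K (\<lambda>_. unif01))"
    using K by (simp add: U.product_nn_integral_insert)
  also have "\<dots> = (\<integral>\<^sup>+s. \<integral>\<^sup>+y. f (pairing K s m + of_int (m j) * y) \<partial>unif01 \<partial>PiM K (\<lambda>_. unif01))"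
    by (simp only: upd)
  also have "\<dots> = (\<integral>\<^sup>+x. f x \<partial>unif01)"
    using j per by (simp add: nn_integral_unif01_affine PK.emeasure_space_1)
  finally show ?thesis .
qed

text \<open>An integer 2 x 2 matrix with nonzero determinant preserves Haar measure of the 2-torus,
  so its two components are independent and uniform, also after a translation.\<close>

lemma nn_integral_unif01_two:
  fixes a b c d :: int
  assumes f[measurable]: "f \<in> borel_measurable borel" and g[measurable]: "g \<in> borel_measurable borel"
    and perf: "\<And>x. f (x + 1) = f x" and perg: "\<And>x. g (x + 1) = g x"
    and b: "b \<noteq> 0" and D: "a * d \<noteq> b * c"
  shows "(\<integral>\<^sup>+x. \<integral>\<^sup>+y. f (t + of_int a * x + of_int b * y) * g (u + of_int c * x + of_int d * y) \<partial>unif01 \<partial>unif01)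
    = (\<integral>\<^sup>+x. f x \<partial>unif01) * (\<integral>\<^sup>+x. g x \<partial>unif01)"
proof -
  interpret P: prob_space unif01 by (rule prob_space_unif01)
  interpret PP: pair_sigma_finite unif01 unif01 ..
  define F where "F x y = f (t + of_int a * x + of_int b * y) * g (u + of_int c * x + of_int d * y)"
    for x y
  have [measurable]: "case_prod F \<in> borel_measurable (unif01 \<Otimes>\<^sub>M unif01)"
    unfolding F_def by measurable
  have pf: "f (x + of_int k) = f x" and pg: "g (x + of_int k) = g x" for x k
    by (auto intro: periodic_of_int perf perg)
  have Fx: "F (x + 1) y = F x y" for x y
    using pf[of "t + of_int a * x + of_int b * y" a] pg[of "u + of_int c * x + of_int d * y" c]
    by (simp add: F_def algebra_simps)
  have Fy: "F x (y + 1) = F x y" for x y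
    using pf[of "t + of_int a * x + of_int b * y" b] pg[of "u + of_int c * x + of_int d * y" d]
    by (simp add: F_def algebra_simps)
  \<comment> \<open>Elimination by measure-preserving substitutions: x becomes b x, then y becomes y
    - a x. Afterwards the first form no longer contains x, and the second contains it with
    coefficient b c - a d, so x can be integrated out of the second factor alone.\<close>
  have "(\<integral>\<^sup>+x. \<integral>\<^sup>+y. F x y \<partial>unif01 \<partial>unif01) = (\<integral>\<^sup>+x. \<integral>\<^sup>+y. F (of_int b * x) y \<partial>unif01 \<partial>unif01)"
    using nn_integral_unif01_affine[of "\<lambda>x. \<integral>\<^sup>+y. F x y \<partial>unif01" b 0] b by (simp add: Fx)
  also have "\<dots> = (\<integral>\<^sup>+x. \<integral>\<^sup>+y. F (of_int b * x) (- of_int a * x + y) \<partial>unif01 \<partial>unif01)"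
    using nn_integral_unif01_affine[of "F (of_int b * x)" 1 "- of_int a * x" for x] 
    by (simp add: Fy)
  also have "\<dots> = (\<integral>\<^sup>+y. \<integral>\<^sup>+x. F (of_int b * x) (- of_int a * x + y) \<partial>unif01 \<partial>unif01)"
    by (rule PP.Fubini') measurable
  also have "\<dots> = (\<integral>\<^sup>+y. \<integral>\<^sup>+x. f (t + of_int b * y) * g (u + of_int d * y + of_int (b * c - a * d) * x) \<partial>unif01 \<partial>unif01)"
    by (simp add: F_def algebra_simps)
  also have "\<dots> = (\<integral>\<^sup>+y. f (t + of_int b * y) * (\<integral>\<^sup>+x. g x \<partial>unif01) \<partial>unif01)"
    using D nn_integral_unif01_affine[OF g perg, of "b * c - a * d"] by (simp add: nn_integral_cmult)
  also have "\<dots> = (\<integral>\<^sup>+x. f x \<partial>unif01) * (\<integral>\<^sup>+x. g x \<partial>unif01)"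
    using b by (simp add: nn_integral_multc nn_integral_unif01_affine perf)
  finally show ?thesis by (simp add: F_def)
qed

text \<open>Non-parallel integer vectors have a nonzero 2 x 2 minor. With the other coordinates
  frozen this is the two-variable case, so the two linear forms are independent mod 1.\<close>

lemma nn_integral_unif01_pairing_two:
  assumes J: "finite J" and [measurable]: "f \<in> borel_measurable borel" "g \<in> borel_measurable borel"
    and per: "\<And>x. f (x + 1) = f x" "\<And>x. g (x + 1) = g x"
    and nz: "j\<^sub>0 \<in> J" "m j\<^sub>0 \<noteq> 0"
    and ij: "i \<in> J" "j \<in> J" "m i * m' j \<noteq> m j * m' i"
  shows "(\<integral>\<^sup>+s. f (pairing J s m) * g (pairing J s m') \<partial>PiM J (\<lambda>_. unif01)) =
    (\<integral>\<^sup>+x. f x \<partial>unif01) * (\<integral>\<^sup>+x. g x \<partial>unif01)"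
proof -
  \<comment> \<open>The two-variable case divides by the coefficient \<open>m l\<close>. If
    \<open>m j = 0\<close>, the nonzero minor forces \<open>m i \<noteq> 0\<close>, and i and j
    exchange roles.\<close>
  obtain k l where kl: "k \<in> J" "l \<in> J" "m l \<noteq> 0" "m k * m' l \<noteq> m l * m' k"
    using ij by (cases "m j = 0") (metis mult_zero_left)+
  then have "k \<noteq> l" by auto
  define K where "K = J - {k, l}"
  have K: "J = insert k (insert l K)" "k \<notin> insert l K" "l \<notin> K" "finite K"
    using kl J \<open>k \<noteq> l\<close> by (auto simp: K_def)
  interpret PK: prob_space "PiM K (\<lambda>_. unif01)"
    by (intro prob_space_PiM prob_space_unif01)
  have upd: "pairing K (s(l := y, k := x)) m = pairing K s m" for s y x m
    using K by (intro sum.cong) auto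
  have P: "pairing J (s(l := y, k := x)) m = pairing K s m + of_int (m k) * x + of_int (m l) * y" for s x y m
    using K(2-4) upd[of s y x m] \<open>k \<noteq> l\<close>
    by (subst K(1)) (simp del: fun_upd_apply, simp add: algebra_simps)
  define F where "F s = f (pairing J s m) * g (pairing J s m')" for s
  have [measurable]: "F \<in> borel_measurable (PiM J (\<lambda>_. unif01))"
    unfolding F_def by measurable
  have Fm[measurable]: "F \<in> borel_measurable (PiM (insert k (insert l K)) (\<lambda>_. unif01))"
    unfolding K(1)[symmetric] by measurable
  have swap: "(\<integral>\<^sup>+y. \<integral>\<^sup>+x. F (s(l := y, k := x)) \<partial>unif01 \<partial>unif01)
      = (\<integral>\<^sup>+x. \<integral>\<^sup>+y. F (s(l := y, k := x)) \<partial>unif01 \<partial>unif01)" for s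
  proof -
    interpret U1: prob_space unif01 by (rule prob_space_unif01)
    interpret PP: pair_sigma_finite unif01 unif01 ..
    show ?thesis
      unfolding F_def P by (rule PP.Fubini') measurable
  qed
  have "(\<integral>\<^sup>+s. F s \<partial>PiM J (\<lambda>_. unif01)) =
     (\<integral>\<^sup>+s. \<integral>\<^sup>+y. \<integral>\<^sup>+x. F (s(l := y, k := x)) \<partial>unif01 \<partial>unif01 \<partial>PiM K (\<lambda>_. unif01))"
    using K(2-4) by (subst K(1)) (simp add: U.product_nn_integral_insert)
  also have "\<dots> = (\<integral>\<^sup>+s. \<integral>\<^sup>+x. \<integral>\<^sup>+y. F (s(l := y, k := x)) \<partial>unif01 \<partial>unif01 \<partial>PiM K (\<lambda>_. unif01))"
    by (simp add: swap)
  also have "\<dots> = (\<integral>\<^sup>+x. f x \<partial>unif01) * (\<integral>\<^sup>+x. g x \<partial>unif01)"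
    unfolding F_def P
    by (subst nn_integral_unif01_two) (use kl per in \<open>auto simp: PK.emeasure_space_1\<close>)
  finally show ?thesis by (simp add: F_def)
qed

section \<open>Second moments and parallel pairs\<close>

text \<open>Second moment method: let X count the events that occur. Pairs outside \<open>R\<close>
  contribute p^2 each, as in the square of the mean, so the variance is at most |R| p. If no event
  occurs, X = 0 deviates from its mean by |W| p, and Chebyshev's inequality applies.\<close>

lemma (in prob_space) prob_avoid_all_le:
  assumes W: "finite W" "W \<noteq> {}" and A[measurable]: "\<And>m. m \<in> W \<Longrightarrow> A m \<in> events"
    and p: "p > 0" "\<And>m. m \<in> W \<Longrightarrow> prob (A m) = p"
    and R: "R \<subseteq> W \<times> W"
    and indep: "\<And>m m'. m \<in> W \<Longrightarrow> m' \<in> W \<Longrightarrow> (m, m') \<notin> R \<Longrightarrow> prob (A m \<inter> A m') = p\<^sup>2"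
  shows "prob (space M - (\<Union>m\<in>W. A m)) \<le> real (card R) / (p * (real (card W))\<^sup>2)"
proof -
  define X :: "'a \<Rightarrow> real" where "X \<omega> = (\<Sum>m\<in>W. indicator (A m) \<omega>)" for \<omega>
  have finR: "finite R"
    using R W by (meson finite_SigmaI finite_subset)
  have cW: "real (card W) > 0"
    using W by (simp add: card_gt_0_iff)
  have ind: "integrable M (indicator B :: 'a \<Rightarrow> real)" if "B \<in> events" for B
    using that by (intro integrable_real_indicator) (auto simp: less_top[symmetric])
  have [measurable]: "X \<in> borel_measurable M"
    unfolding X_def using A by measurable
  have int: "integrable M X"
    unfolding X_def using A
    by (intro Bochner_Integration.integrable_sum ind) auto
  have EX: "expectation X = real (card W) * p"
    unfolding X_def using A p by (subst Bochner_Integration.integral_sum) (auto intro!: ind)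
  have X2: "(X \<omega>)\<^sup>2 = (\<Sum>(m, m')\<in>W \<times> W. indicator (A m \<inter> A m') \<omega>)" for \<omega>
    by (simp add: X_def power2_eq_square sum_product sum.cartesian_product indicator_inter_arith)
  have int2: "integrable M (\<lambda>\<omega>. (X \<omega>)\<^sup>2)"
    unfolding X2 case_prod_unfold using A
    by (intro Bochner_Integration.integrable_sum ind) auto
  have "expectation (\<lambda>\<omega>. (X \<omega>)\<^sup>2) = (\<Sum>(m, m')\<in>W \<times> W. prob (A m \<inter> A m'))"
    unfolding X2 case_prod_unfold using A
    by (subst Bochner_Integration.integral_sum) (auto intro!: sum.cong ind)
  also have "\<dots> = (\<Sum>(m, m')\<in>R. prob (A m \<inter> A m')) + (\<Sum>(m, m')\<in>W \<times> W - R. prob (A m \<inter> A m'))"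
    using R W by (subst sum.subset_diff[of R]) auto
  also have "\<dots> \<le> (\<Sum>x\<in>R. p) + (\<Sum>x\<in>W \<times> W - R. p\<^sup>2)"
  proof (intro add_mono sum_mono)
    fix x assume "x \<in> R"
    then have "fst x \<in> W" using R by auto
    then have "prob (A (fst x) \<inter> A (snd x)) \<le> prob (A (fst x))"
      by (intro finite_measure_mono A) auto
    then show "(case x of (m, m') \<Rightarrow> prob (A m \<inter> A m')) \<le> p"
      using p(2)[OF \<open>fst x \<in> W\<close>] by (simp add: case_prod_unfold)
  next
    fix x assume "x \<in> W \<times> W - R"
    then show "(case x of (m, m') \<Rightarrow> prob (A m \<inter> A m')) \<le> p\<^sup>2"
      using indep by auto
  qed
  also have "\<dots> \<le> real (card R) * p + real (card W * card W) * p\<^sup>2"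
    using p(1) W card_mono[of "W \<times> W" "W \<times> W - R"]
    by (auto simp: card_cartesian_product intro!: mult_right_mono of_nat_mono simp del: of_nat_mult)
  finally have "variance X \<le> real (card R) * p"
    unfolding variance_eq[OF int int2] unfolding EX by (simp add: power2_eq_square algebra_simps)
  moreover have "prob (space M - (\<Union>m\<in>W. A m)) \<le> prob {\<omega>\<in>space M. real (card W) * p \<le> \<bar>X \<omega> - expectation X\<bar>}"
  proof (rule finite_measure_mono)
    show "space M - (\<Union>m\<in>W. A m) \<subseteq> {\<omega>\<in>space M. real (card W) * p \<le> \<bar>X \<omega> - expectation X\<bar>}"
      using p(1) by (auto simp: X_def EX)
  qed measurable
  moreover have "\<dots> \<le> variance X / (real (card W) * p)\<^sup>2"
    using p cW by (intro Chebyshev_inequality int2) auto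
  ultimately have "prob (space M - (\<Union>m\<in>W. A m)) \<le> real (card R) * p / (real (card W) * p)\<^sup>2"
    by (meson divide_right_mono order_trans zero_le_power2)
  also have "\<dots> = real (card R) / (p * (real (card W))\<^sup>2)"
    using p cW by (simp add: power2_eq_square field_simps)
  finally show ?thesis .
qed

section \<open>Counting parallel pairs of integer vectors\<close>

definition parallel_on :: "'j set \<Rightarrow> ('j \<Rightarrow> int) \<Rightarrow> ('j \<Rightarrow> int) \<Rightarrow> bool" where
  "parallel_on J m m' \<longleftrightarrow> (\<forall>i\<in>J. \<forall>j\<in>J. m i * m' j = m j * m' i)"

text \<open>Dividing \<open>m\<close> by its content \<open>g\<close> leaves a primitive vector
  \<open>u\<close>, and every integer vector parallel to a primitive one is an integer multiple of
  it.\<close>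

lemma parallel_on_common_multiple:
  assumes J: "finite J" and par: "parallel_on J m m'" and nz: "j \<in> J" "m j \<noteq> 0"
  obtains g g' u where "g > 0" "\<And>j. j \<in> J \<Longrightarrow> m j = g * u j" "\<And>j. j \<in> J \<Longrightarrow> m' j = g' * u j"
proof -
  define g where "g = Gcd (m ` J)"
  have g: "g > 0"
    using nz by (auto simp: g_def less_le)
  define u where "u j = m j div g" for j
  have mu: "m j = g * u j" if "j \<in> J" for j
    using that by (simp add: u_def g_def Gcd_dvd)
  have Gu: "Gcd (u ` J) = 1"
  proof -
    have "g = Gcd ((*) g ` (u ` J))"
      using mu by (simp add: g_def image_image cong: image_cong)
    also have "\<dots> = g * Gcd (u ` J)"
      using g by (simp add: Gcd_mult abs_mult)
    finally show ?thesis using g by simp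
  qed
  have uj: "u j \<noteq> 0" using mu nz by auto
  have cross: "u i * m' j = u j * m' i" if "i \<in> J" for i
    using par nz that g by (auto simp: parallel_on_def mu algebra_simps)
  \<comment> \<open>By \<open>cross\<close>, \<open>u j\<close> divides \<open>m' j * u i\<close>
    for every i, hence also the gcd of these products, which is \<open>m' j\<close> up to sign
    because \<open>u\<close> is primitive.\<close>
  have "u j dvd Gcd ((*) (m' j) ` (u ` J))"
    using cross by (intro Gcd_greatest) (auto simp: mult.commute[of "m' j"])
  then have "u j dvd m' j"
    by (simp add: Gcd_mult Gu)
  then obtain g' where g': "m' j = u j * g'" by auto
  have "m' i = g' * u i" if "i \<in> J" for i
    using cross[OF that] uj g' by (simp add: algebra_simps)
  then show thesis using that g mu by blast
qed

text \<open>Ordered parallel pairs are of the form \<open>(g u, g' u)\<close> with \<open>\<bar>g'\<bar> \<le> g\<close>, up to exchanging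
  the two components.\<close>

lemma card_parallel_le:
  fixes L :: nat
  assumes J: "finite J" "card J \<ge> 2"
    and W: "W \<subseteq> (\<Pi>\<^sub>E j\<in>J. {- int L..int L})" "\<And>m. m \<in> W \<Longrightarrow> \<exists>j\<in>J. m j \<noteq> 0"
  shows "real (card {(m, m') \<in> W \<times> W. parallel_on J m m'})
     \<le> 6 * (3 * real L) ^ card J * (\<Sum>g=1..L. 1 / real g)"
proof -
  define b where "b = card J"
  \<comment> \<open>The triples hold g, g' and u. The range of u comes from g |u j| <= L; it shrinks
    fast enough in g to keep the count near L to the power \<open>card J\<close>.\<close>
  define T where "T = (SIGMA g:{1..L}. {- int g..int g} \<times> (\<Pi>\<^sub>E j\<in>J. {- int (L div g)..int (L div g)}))"
  define \<phi> :: "nat \<times> int \<times> ('a \<Rightarrow> int) \<Rightarrow> ('a \<Rightarrow> int) \<times> ('a \<Rightarrow> int)" where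
    "\<phi> = (\<lambda>(g, g', u). (restrict (\<lambda>j. int g * u j) J, restrict (\<lambda>j. g' * u j) J))"
  have finT: "finite T"
    using J by (auto simp: T_def intro!: finite_SigmaI finite_PiE)
  have key: "(m, m') \<in> \<phi> ` T"
    if W: "m \<in> W" "m' \<in> W" and g: "g > 0" "\<bar>g'\<bar> \<le> g"
      and m: "\<And>j. j \<in> J \<Longrightarrow> m j = g * u j" and m': "\<And>j. j \<in> J \<Longrightarrow> m' j = g' * u j" for m m' g g' u
  proof -
    have mP: "m \<in> (\<Pi>\<^sub>E j\<in>J. {- int L..int L})" "m' \<in> (\<Pi>\<^sub>E j\<in>J. {- int L..int L})"
      using assms(3) W by blast+
    then have ext: "m \<in> extensional J" "m' \<in> extensional J"
      by (auto simp: PiE_def)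
    have mL: "\<bar>m j\<bar> \<le> int L" if "j \<in> J" for j
      using PiE_mem[OF mP(1) that] by (simp add: abs_le_iff)
    have gu: "g * \<bar>u j\<bar> \<le> int L" if "j \<in> J" for j
      using mL[OF that] g by (simp add: m[OF that] abs_mult)
    obtain j where "j \<in> J" "m j \<noteq> 0"
      using assms(4) W by blast
    then have "\<bar>u j\<bar> \<ge> 1" by (auto simp: m)
    then have "g * 1 \<le> g * \<bar>u j\<bar>"
      using g by (intro mult_left_mono) auto
    then have gL: "g \<le> int L" using gu[OF \<open>j \<in> J\<close>] by simp
    have u: "\<bar>u j\<bar> \<le> int (L div nat g)" if "j \<in> J" for j
      using zdiv_mono1[OF gu[OF that] g(1)] g by (simp add: zdiv_int)
    have "(nat g, g', restrict u J) \<in> T"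
      using g gL u by (auto simp: T_def abs_le_iff minus_le_iff)
    moreover have "(m, m') = \<phi> (nat g, g', restrict u J)"
      using ext g m m' by (auto simp: \<phi>_def fun_eq_iff extensional_def)
    ultimately show ?thesis by (intro image_eqI)
  qed
  have sub: "{(m, m') \<in> W \<times> W. parallel_on J m m'} \<subseteq> \<phi> ` T \<union> prod.swap ` \<phi> ` T"
  proof
    fix x assume "x \<in> {(m, m') \<in> W \<times> W. parallel_on J m m'}"
    then obtain m m' where x: "x = (m, m')" and W': "m \<in> W" "m' \<in> W" and par: "parallel_on J m m'"
      by auto
    obtain j where "j \<in> J" "m j \<noteq> 0"
      using W W' by blast
    then obtain g g' u where g: "g > 0"
      "\<And>j. j \<in> J \<Longrightarrow> m j = g * u j" "\<And>j. j \<in> J \<Longrightarrow> m' j = g' * u j"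
      by (rule parallel_on_common_multiple[OF J(1) par]) (rule that)
    show "x \<in> \<phi> ` T \<union> prod.swap ` \<phi> ` T"
    proof (cases "\<bar>g'\<bar> \<le> g")
      case True
      have "(m, m') \<in> \<phi> ` T"
        by (rule key[OF W' g(1) True g(2,3)])
      then show ?thesis by (simp add: x)
    next
      case False
      then have nz: "g' \<noteq> 0" using g(1) by auto
      \<comment> \<open>The roles of m and m' are exchanged. As g' may be negative, its sign moves
        into \<open>u\<close>, which leaves the positive multiplier |g'|.\<close>
      have 1: "m' j = \<bar>g'\<bar> * (sgn g' * u j)" if "j \<in> J" for j
        unfolding g(3)[OF that] by (simp add: abs_mult_sgn mult.assoc[symmetric])
      have 2: "m j = (sgn g' * g) * (sgn g' * u j)" if "j \<in> J" for j
        unfolding g(2)[OF that] using nz by (simp add: sgn_if)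
      have 3: "\<bar>sgn g' * g\<bar> \<le> \<bar>g'\<bar>"
        using False g(1) nz by (simp add: abs_mult)
      have "(m', m) \<in> \<phi> ` T"
        by (rule key[OF W'(2,1) _ 3 1 2]) (use nz in simp)
      then have "(m, m') \<in> prod.swap ` \<phi> ` T"
        by (intro image_eqI[of _ prod.swap "(m', m)"]) simp
      then show ?thesis by (simp add: x)
    qed
  qed
  have "card {(m, m') \<in> W \<times> W. parallel_on J m m'} \<le> card (\<phi> ` T) + card (prod.swap ` \<phi> ` T)"
    using card_mono[OF _ sub] finT card_Un_le[of "\<phi> ` T" "prod.swap ` \<phi> ` T"] by simp
  also have "\<dots> \<le> 2 * card T"
    using card_image_le[OF finT, of \<phi>] card_image_le[of "\<phi> ` T" prod.swap] finT by simp
  also have "card T = (\<Sum>g=1..L. (2 * g + 1) * (2 * (L div g) + 1) ^ b)"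
    unfolding T_def b_def using J
    by (subst card_SigmaI) (auto simp: card_cartesian_product card_PiE nat_add_distrib nat_mult_distrib
         finite_PiE intro!: sum.cong)
  also have "real (2 * (\<Sum>g=1..L. (2 * g + 1) * (2 * (L div g) + 1) ^ b))
      = 2 * (\<Sum>g=1..L. (2 * real g + 1) * (2 * real (L div g) + 1) ^ b)"
    by (simp add: algebra_simps)
  also have "\<dots> \<le> 2 * (\<Sum>g=1..L. 3 * (3 * real L) ^ b * (1 / real g))"
  proof (intro mult_left_mono sum_mono)
    fix g assume g: "g \<in> {1..L}"
    have "real (L div g) \<le> real L / real g"
      by (rule of_nat_div_le_of_nat)
    moreover have "real L / real g \<ge> 1"
      using g by simp
    ultimately have 1: "(2 * real (L div g) + 1) ^ b \<le> (3 * (real L / real g)) ^ b"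
      by (intro power_mono) auto
    have "(2 * real g + 1) * (2 * real (L div g) + 1) ^ b \<le> (3 * real g) * (3 * (real L / real g)) ^ b"
      using g by (intro mult_mono 1) auto
    also have "\<dots> = 3 * (3 * real L) ^ b * (real g / real g ^ b)"
      by (simp add: power_mult_distrib power_divide)
    also have "\<dots> \<le> 3 * (3 * real L) ^ b * (1 / real g)"
    proof (rule mult_left_mono)
      \<comment> \<open>Because b >= 2, the factor g / g^b is at most 1 / g, so summing over g costs
        only a harmonic sum.\<close>
      have "real g ^ 2 \<le> real g ^ b"
        using g J by (intro power_increasing) (auto simp: b_def)
      then show "real g / real g ^ b \<le> 1 / real g"
        using g by (simp add: field_simps power2_eq_square)
    qed auto
    finally show "(2 * real g + 1) * (2 * real (L div g) + 1) ^ b \<le> 3 * (3 * real L) ^ b * (1 / real g)" .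
  qed auto
  also have "\<dots> = 6 * (3 * real L) ^ b * (\<Sum>g=1..L. 1 / real g)"
    by (simp add: sum_distrib_left)
  finally show ?thesis by (simp add: b_def)
qed

text \<open>Logarithmic growth is absorbed into an arbitrarily small power: 1 / g = g^(-1-e) g^e,
  where g^e <= L^e and the series of g^(-1-e) converges.\<close>

lemma harmonic_sum_le_powr:
  fixes e :: real
  assumes "e > 0"
  obtains Z where "Z > 0" "\<And>L::nat. (\<Sum>g=1..L. 1 / real g) \<le> Z * real L powr e"
proof
  have s: "summable (\<lambda>n::nat. real n powr (- 1 - e))"
    using assms by (simp add: summable_real_powr_iff)
  define Z where "Z = (\<Sum>n::nat. real n powr (- 1 - e)) + 1"
  have Z0: "(\<Sum>n::nat. real n powr (- 1 - e)) \<ge> 0"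
    by (intro suminf_nonneg s) auto
  then show "Z > 0" by (simp add: Z_def)
  fix L :: nat
  have "(\<Sum>g=1..L. 1 / real g) \<le> (\<Sum>g=1..L. real g powr (- 1 - e) * real L powr e)"
  proof (rule sum_mono)
    fix g assume g: "g \<in> {1..L}"
    have "1 / real g = real g powr (- 1 - e) * real g powr e"
      using g by (simp add: powr_add[symmetric] powr_minus_divide)
    also have "\<dots> \<le> real g powr (- 1 - e) * real L powr e"
      using g assms by (intro mult_left_mono powr_mono2) auto
    finally show "1 / real g \<le> real g powr (- 1 - e) * real L powr e" .
  qed
  also have "\<dots> = (\<Sum>g=1..L. real g powr (- 1 - e)) * real L powr e"
    by (simp add: sum_distrib_right)
  also have "\<dots> \<le> Z * real L powr e"
    using sum_le_suminf[OF s, of "{1..L}"] by (intro mult_right_mono) (auto simp: Z_def)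
  finally show "(\<Sum>g=1..L. 1 / real g) \<le> Z * real L powr e" .
qed

section \<open>Inhomogeneous approximation for almost every point\<close>

definition near_int :: "real \<Rightarrow> real \<Rightarrow> real \<Rightarrow> bool" where
  "near_int \<psi> r u \<longleftrightarrow> (\<exists>x::int. \<bar>of_int x + u - r\<bar> < \<psi>)"

lemma near_int_measurable [measurable]: "Measurable.pred borel (near_int \<psi> r)"
  unfolding near_int_def by measurable

lemma near_int_add_of_int [simp]: "near_int \<psi> r (u + of_int k) \<longleftrightarrow> near_int \<psi> r u"
proof
  assume "near_int \<psi> r (u + of_int k)"
  then obtain x where "\<bar>of_int x + (u + of_int k) - r\<bar> < \<psi>"
    by (auto simp: near_int_def)
  then have "\<bar>of_int (x + k) + u - r\<bar> < \<psi>"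
    by (simp add: algebra_simps)
  then show "near_int \<psi> r u" unfolding near_int_def by blast
next
  assume "near_int \<psi> r u"
  then obtain x where "\<bar>of_int x + u - r\<bar> < \<psi>"
    by (auto simp: near_int_def)
  then have "\<bar>of_int (x - k) + (u + of_int k) - r\<bar> < \<psi>"
    by (simp add: algebra_simps)
  then show "near_int \<psi> r (u + of_int k)" unfolding near_int_def by blast
qed

lemma near_int_add_1 [simp]: "near_int \<psi> r (u + 1) \<longleftrightarrow> near_int \<psi> r u"
  using near_int_add_of_int[of \<psi> r u 1] by simp

lemma near_int_shift: "near_int \<psi> r (r + u) \<longleftrightarrow> near_int \<psi> 0 u"
  by (simp add: near_int_def algebra_simps)

text \<open>Only a lower bound on this probability enters the avoidance estimate, so the one-sided
  arc [0, \<psi>) is enough.\<close>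

lemma measure_near_int_ge:
  assumes "0 < \<psi>" "\<psi> \<le> 1"
  shows "measure unif01 {u. near_int \<psi> 0 u} \<ge> \<psi>"
proof -
  interpret prob_space unif01 by (rule prob_space_unif01)
  have "emeasure unif01 {0..<\<psi>} = ennreal \<psi>"
    using assms by (simp add: unif01_def emeasure_density nn_integral_indicator indicator_inter_arith[symmetric])
  then have "measure unif01 {0..<\<psi>} = \<psi>"
    using assms by (simp add: measure_def)
  moreover have "measure unif01 {0..<\<psi>} \<le> measure unif01 {u. near_int \<psi> 0 u}"
    by (rule finite_measure_mono) (auto simp: near_int_def intro!: exI[of _ 0])
  ultimately show ?thesis by simp
qed

text \<open>The second moment bound, with the parallel pairs as exceptional set. The targets
  \<open>r m\<close> may be arbitrary: rotating the circle by \<open>r m\<close> shows that all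
  events have the same probability.\<close>

lemma prob_no_near_int_le:
  fixes r :: "('j \<Rightarrow> int) \<Rightarrow> real"
  assumes J: "finite J" and W: "finite W" "W \<noteq> {}" "\<And>m. m \<in> W \<Longrightarrow> \<exists>j\<in>J. m j \<noteq> 0"
    and \<psi>: "0 < \<psi>" "\<psi> \<le> 1"
  shows "measure (PiM J (\<lambda>_. unif01))
      {s \<in> space (PiM J (\<lambda>_. unif01)). \<forall>m\<in>W. \<not> near_int \<psi> (r m) (pairing J s m)}
    \<le> real (card {(m, m') \<in> W \<times> W. parallel_on J m m'}) / (\<psi> * (real (card W))\<^sup>2)"
proof -
  let ?P = "PiM J (\<lambda>_. unif01)"
  let ?R = "{(m, m') \<in> W \<times> W. parallel_on J m m'}"
  interpret P: prob_space ?P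
    by (intro prob_space_PiM prob_space_unif01)
  interpret U1: prob_space unif01 by (rule prob_space_unif01)
  define p where "p = measure unif01 {u. near_int \<psi> 0 u}"
  have p: "p \<ge> \<psi>" using measure_near_int_ge[OF \<psi>] by (simp add: p_def)
  define A where "A m = {s \<in> space ?P. near_int \<psi> (r m) (pairing J s m)}" for m
  have [measurable]: "A m \<in> sets ?P" for m
    unfolding A_def by measurable
  define h :: "('j \<Rightarrow> int) \<Rightarrow> real \<Rightarrow> ennreal" where "h m = indicator {u. near_int \<psi> (r m) u}" for m
  have [measurable]: "h m \<in> borel_measurable borel" for m
    unfolding h_def by measurable
  have per: "h m (x + 1) = h m x" for m x
    by (simp add: h_def indicator_def)
  have inth: "(\<integral>\<^sup>+x. h m x \<partial>unif01) = ennreal p" for m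
  proof -
    have "h m (r m + x) = indicator {u. near_int \<psi> 0 u} x" for x
      by (simp add: h_def indicator_def near_int_shift)
    then have "(\<integral>\<^sup>+x. h m x \<partial>unif01) = emeasure unif01 {u. near_int \<psi> 0 u}"
      using nn_integral_unif01_affine[of "h m" 1 "r m"] per by simp
    then show ?thesis by (simp add: p_def U1.emeasure_eq_measure)
  qed
  have indA: "indicator (A m) s = h m (pairing J s m)" if "s \<in> space ?P" for m s
    using that by (simp add: A_def h_def indicator_def)
  have PA: "measure ?P (A m) = p" if m: "m \<in> W" for m
  proof -
    obtain j where "j \<in> J" "m j \<noteq> 0" using W(3)[OF m] by blast
    have "emeasure ?P (A m) = (\<integral>\<^sup>+s. h m (pairing J s m) \<partial>?P)"
      by (subst nn_integral_indicator[symmetric]) (simp, intro nn_integral_cong indA)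
    also have "\<dots> = ennreal p"
      using \<open>j \<in> J\<close> \<open>m j \<noteq> 0\<close> J per by (subst nn_integral_unif01_pairing) (auto simp: inth)
    finally show ?thesis using p \<psi> by (simp add: measure_def)
  qed
  have PAA: "measure ?P (A m \<inter> A m') = p\<^sup>2" if m: "m \<in> W" "m' \<in> W" "(m, m') \<notin> ?R" for m m'
  proof -
    obtain j0 where j0: "j0 \<in> J" "m j0 \<noteq> 0" using W(3) m by blast
    obtain i j where ij: "i \<in> J" "j \<in> J" "m i * m' j \<noteq> m j * m' i"
      using m by (auto simp: parallel_on_def)
    have "emeasure ?P (A m \<inter> A m') = (\<integral>\<^sup>+s. h m (pairing J s m) * h m' (pairing J s m') \<partial>?P)"
      by (subst nn_integral_indicator[symmetric])
         (simp, intro nn_integral_cong, simp add: indicator_inter_arith indA)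
    also have "\<dots> = ennreal p * ennreal p"
      using nn_integral_unif01_pairing_two[OF J _ _ _ _ j0 ij, of "h m" "h m'"] per by (simp add: inth)
    finally show ?thesis using p \<psi> by (simp add: measure_def ennreal_mult[symmetric] power2_eq_square)
  qed
  have "measure ?P (space ?P - (\<Union>m\<in>W. A m)) \<le> real (card ?R) / (p * (real (card W))\<^sup>2)"
    using p \<psi> PA PAA W by (intro P.prob_avoid_all_le) auto
  also have "\<dots> \<le> real (card ?R) / (\<psi> * (real (card W))\<^sup>2)"
    using p \<psi> W by (intro divide_left_mono mult_right_mono mult_pos_pos) auto
  also have "space ?P - (\<Union>m\<in>W. A m) = {s \<in> space ?P. \<forall>m\<in>W. \<not> near_int \<psi> (r m) (pairing J s m)}"
    by (auto simp: A_def)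
  finally show ?thesis .
qed

text \<open>The integer points of the M-fold dilate of the unit cube with corner \<open>V\<close>;
  they stay in the cone over that cube for every M.\<close>

definition int_box :: "'j set \<Rightarrow> ('j \<Rightarrow> int) \<Rightarrow> nat \<Rightarrow> ('j \<Rightarrow> int) set" where
  "int_box J V M = (\<Pi>\<^sub>E j\<in>J. {int M * V j..int M * V j + int M})"

lemma finite_int_box: "finite J \<Longrightarrow> finite (int_box J V M)"
  by (auto simp: int_box_def intro!: finite_PiE)

lemma card_int_box: "finite J \<Longrightarrow> card (int_box J V M) = (M + 1) ^ card J"
  by (simp add: int_box_def card_PiE nat_add_distrib)

lemma int_box_abs_le:
  assumes "finite J" "m \<in> int_box J V M" "j \<in> J"
  shows "\<bar>m j\<bar> \<le> int (nat (\<Sum>i\<in>J. \<bar>V i\<bar> + 1) * M)"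
proof -
  have "\<bar>V j\<bar> + 1 \<le> (\<Sum>i\<in>J. \<bar>V i\<bar> + 1)"
    using assms by (intro member_le_sum) auto
  then have 1: "(\<bar>V j\<bar> + 1) * int M \<le> (\<Sum>i\<in>J. \<bar>V i\<bar> + 1) * int M"
    by (intro mult_right_mono) auto
  have m: "int M * V j \<le> m j" "m j \<le> int M * V j + int M"
    using assms by (auto simp: int_box_def PiE_iff)
  have "\<bar>int M * V j\<bar> = int M * \<bar>V j\<bar>"
    by (simp add: abs_mult)
  then have "\<bar>m j\<bar> \<le> int M * \<bar>V j\<bar> + int M"
    using m by linarith
  also have "\<dots> \<le> (\<Sum>i\<in>J. \<bar>V i\<bar> + 1) * int M"
    using 1 by (simp add: algebra_simps)
  finally show ?thesis
    by (simp add: sum_nonneg)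
qed

text \<open>The vector size \<epsilon>^(-\<tau>) belonging to \<epsilon> = 2^(-k), rounded up. For
  \<tau> > 0 the power is at least 1, so rounding costs at most a factor 2.\<close>

definition scale :: "real \<Rightarrow> nat \<Rightarrow> nat" where
  "scale \<tau> k = nat \<lceil>2 powr (real k * \<tau>)\<rceil>"

lemma scale_bounds:
  assumes "\<tau> > 0"
  shows "scale \<tau> k \<ge> 1" "2 powr (real k * \<tau>) \<le> real (scale \<tau> k)" "real (scale \<tau> k) \<le> 2 * 2 powr (real k * \<tau>)"
proof -
  have "2 powr (real k * \<tau>) \<ge> 1"
    using assms by (intro ge_one_powr_ge_zero) auto
  then show "scale \<tau> k \<ge> 1" "2 powr (real k * \<tau>) \<le> real (scale \<tau> k)" "real (scale \<tau> k) \<le> 2 * 2 powr (real k * \<tau>)"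
    unfolding scale_def by linarith+
qed

text \<open>With b = |J|, the box has about M^b points and at most about M^(b+e) parallel pairs, so
  the failure probability at stage k is at most a constant times 2^k M^(1+e-b). For M about 2^(k
  \<tau>) this decays geometrically, and Borel--Cantelli applies.\<close>

lemma AE_unif01_eventually_near_int:
  fixes r :: "('j \<Rightarrow> int) \<Rightarrow> real" and V :: "'j \<Rightarrow> int"
  assumes J: "finite J" "card J \<ge> 2" and \<eta>: "\<eta> > 0" and A: "0 < A" "A \<le> 1"
    and nz: "\<And>M m. M \<ge> 1 \<Longrightarrow> m \<in> int_box J V M \<Longrightarrow> \<exists>j\<in>J. m j \<noteq> 0"
    and \<tau>: "\<tau> = 1 / (real (card J) - 1) + \<eta>"
  shows "AE s in PiM J (\<lambda>_. unif01). eventually (\<lambda>k. \<exists>m\<in>int_box J V (scale \<tau> k).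
    near_int (A / (2 ^ k * real (scale \<tau> k))) (r m) (pairing J s m)) sequentially"
proof -
  let ?P = "PiM J (\<lambda>_. unif01)"
  interpret P: prob_space ?P
    by (intro prob_space_PiM prob_space_unif01)
  define b where "b = card J"
  have b: "b \<ge> 2" using J by (simp add: b_def)
  have \<tau>0: "\<tau> > 0" "\<tau> > \<eta>" using \<tau> \<eta> b by (auto simp: b_def intro!: add_nonneg_pos)
  define W where "W k = int_box J V (scale \<tau> k)" for k
  define \<psi> where "\<psi> k = A / (2 ^ k * real (scale \<tau> k))" for k
  define B where "B k = {s \<in> space ?P. \<forall>m\<in>W k. \<not> near_int (\<psi> k) (r m) (pairing J s m)}" for k
  have W: "finite (W k)" "card (W k) = (scale \<tau> k + 1) ^ b" "W k \<noteq> {}" for k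
  proof -
    show "finite (W k)" "card (W k) = (scale \<tau> k + 1) ^ b"
      using J by (auto simp: W_def finite_int_box card_int_box b_def)
    then have "card (W k) \<noteq> 0" by simp
    then show "W k \<noteq> {}" by auto
  qed
  have Bm[measurable]: "B k \<in> sets ?P" for k
    unfolding B_def using W(1)[of k] by measurable
  \<comment> \<open>Without e the exponent in \<open>expo\<close> would be -\<eta> (b - 1). This
    choice gives \<tau> e = \<eta> (b - 1) / 2 and so spends half of the gain on the harmonic
    sum.\<close>
  define e where "e = \<eta> * (real b - 1) / (2 * \<tau>)"
  have e: "e > 0" using \<eta> \<tau>0 b by (simp add: e_def)
  obtain Z where Z: "Z > 0" "\<And>L::nat. (\<Sum>g=1..L. 1 / real g) \<le> Z * real L powr e"
    using harmonic_sum_le_powr[OF e] by blast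
  \<comment> \<open>\<open>C\<close> bounds the box coordinates relative to M. \<open>K0\<close>
    collects the constants of \<open>card_parallel_le\<close> and
    \<open>harmonic_sum_le_powr\<close> and the factor 1 / A from \<psi>.\<close>
  define C where "C = nat (\<Sum>i\<in>J. \<bar>V i\<bar> + 1)"
  define K0 where "K0 = 6 * (3 * real C) ^ b * Z * real C powr e / A"
  \<comment> \<open>This makes 1 + e - b negative, so that M can be replaced by its lower bound 2^(k
    \<tau>) in the power.\<close>
  have e1: "e \<le> (real b - 1) / 2"
  proof -
    have "e = (real b - 1) / 2 * (\<eta> / \<tau>)" by (simp add: e_def)
    also have "\<dots> \<le> (real b - 1) / 2 * 1"
      using \<tau>0 \<eta> b by (intro mult_left_mono) auto
    finally show ?thesis by simp
  qed
  have expo: "1 + \<tau> * (1 + e - real b) = - (\<eta> * (real b - 1) / 2)"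
  proof -
    have "\<tau> * e = \<eta> * (real b - 1) / 2" using \<tau>0 by (simp add: e_def)
    moreover have "\<tau> * (real b - 1) = 1 + \<eta> * (real b - 1)"
      using b by (simp add: \<tau> b_def[symmetric] field_simps)
    moreover have "1 + \<tau> * (1 + e - real b) = 1 + \<tau> * e - \<tau> * (real b - 1)"
      by (simp add: algebra_simps)
    ultimately show ?thesis by linarith
  qed
  have bound: "measure ?P (B k) \<le> K0 * (2 powr (- (\<eta> * (real b - 1) / 2))) ^ k" for k
  proof -
    define M where "M = scale \<tau> k"
    have M: "real M \<ge> 1" "2 powr (real k * \<tau>) \<le> real M" "M \<ge> 1"
      using scale_bounds[OF \<tau>0(1), of k] by (auto simp: M_def)
    have \<psi>k: "0 < \<psi> k" "\<psi> k \<le> 1"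
    proof -
      have "1 * 1 \<le> 2 ^ k * real M" using M by (intro mult_mono) auto
      then show "0 < \<psi> k" "\<psi> k \<le> 1" using A M by (auto simp: \<psi>_def M_def[symmetric] field_simps)
    qed
    have Wnz: "\<exists>j\<in>J. m j \<noteq> 0" if "m \<in> W k" for m
      using that nz[OF M(3)] by (simp add: W_def M_def)
    have WL: "W k \<subseteq> (\<Pi>\<^sub>E j\<in>J. {- int (C * M)..int (C * M)})"
    proof
      fix m assume m: "m \<in> W k"
      have "m j \<in> {- int (C * M)..int (C * M)}" if "j \<in> J" for j
        using int_box_abs_le[OF J(1) _ that, of m V M] m
        by (auto simp: W_def M_def[symmetric] C_def abs_le_iff simp del: of_nat_mult)
      moreover have "m \<in> extensional J"
        using m by (auto simp: W_def int_box_def PiE_def)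
      ultimately show "m \<in> (\<Pi>\<^sub>E j\<in>J. {- int (C * M)..int (C * M)})"
        by (auto simp: PiE_def)
    qed
    have "real (card {(m, m') \<in> W k \<times> W k. parallel_on J m m'})
        \<le> 6 * (3 * real (C * M)) ^ b * (\<Sum>g=1..C * M. 1 / real g)"
      unfolding b_def by (rule card_parallel_le[OF J WL Wnz])
    also have "\<dots> \<le> 6 * (3 * real (C * M)) ^ b * (Z * real (C * M) powr e)"
      by (intro mult_left_mono Z) auto
    also have "\<dots> = (K0 * A) * (real M ^ b * real M powr e)"
      using A by (simp add: K0_def powr_mult power_mult_distrib)
    finally have card: "real (card {(m, m') \<in> W k \<times> W k. parallel_on J m m'})
        \<le> (K0 * A) * (real M ^ b * real M powr e)" .
    have K0: "K0 \<ge> 0" using Z A by (simp add: K0_def)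
    have Wsq: "(real M ^ b)\<^sup>2 \<le> (real (card (W k)))\<^sup>2"
      using W(2)[of k] by (auto simp: M_def intro!: power_mono)
    have "measure ?P (B k) \<le> real (card {(m, m') \<in> W k \<times> W k. parallel_on J m m'})
        / (\<psi> k * (real (card (W k)))\<^sup>2)"
      unfolding B_def by (rule prob_no_near_int_le[OF J(1) W(1,3) Wnz \<psi>k])
    also have "\<dots> \<le> (K0 * A) * (real M ^ b * real M powr e) / (\<psi> k * (real M ^ b)\<^sup>2)"
      using card \<psi>k K0 A M Wsq by (intro frac_le mult_left_mono) auto
    also have "\<dots> = K0 * 2 ^ k * (real M powr e * real M / real M ^ b)"
      using A M by (simp add: \<psi>_def M_def[symmetric] power2_eq_square field_simps)
    also have "real M powr e * real M / real M ^ b = real M powr (1 + e - real b)"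
      using M by (simp add: powr_diff powr_add powr_realpow)
    also have "K0 * 2 ^ k * real M powr (1 + e - real b)
        \<le> K0 * 2 ^ k * (2 powr (real k * \<tau>)) powr (1 + e - real b)"
      using M e1 b K0 by (intro mult_left_mono powr_mono2') auto
    also have "\<dots> = K0 * (2 powr real k * 2 powr (real k * \<tau> * (1 + e - real b)))"
      by (simp add: powr_powr powr_realpow)
    also have "2 powr real k * 2 powr (real k * \<tau> * (1 + e - real b)) = (2::real) powr (real k * (1 + \<tau> * (1 + e - real b)))"
      by (simp add: powr_add[symmetric] algebra_simps)
    also have "\<dots> = (2 powr (- (\<eta> * (real b - 1) / 2))) ^ k"
      unfolding expo by (simp add: powr_powr powr_realpow[symmetric] field_simps)
    finally show ?thesis .
  qed
  have "2 powr (- (\<eta> * (real b - 1) / 2)) < (1::real)"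
    using \<eta> b by (simp add: powr_less_one)
  then have "summable (\<lambda>k. K0 * (2 powr (- (\<eta> * (real b - 1) / 2))) ^ k)"
    by (intro summable_mult summable_geometric) auto
  then have "summable (\<lambda>k. measure ?P (B k))"
    by (rule summable_comparison_test_ev[rotated]) (auto intro!: always_eventually bound)
  then have "AE s in ?P. eventually (\<lambda>k. s \<in> space ?P - B k) sequentially"
    by (intro borel_cantelli_AE1 Bm) (simp add: P.emeasure_eq_measure)
  then show ?thesis
  proof (eventually_elim)
    case (elim s)
    then show ?case
      by (rule eventually_mono) (auto simp: B_def W_def \<psi>_def)
  qed
qed

section \<open>From the torus to Euclidean space\<close>

interpretation L: product_sigma_finite "\<lambda>_. lborel :: real measure"
  by (simp add: product_sigma_finite_def lborel.sigma_finite_measure_axioms)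

text \<open>Integer translates of the unit cube cover the space. The induction peels off one
  coordinate, cuts its line into unit intervals, and applies the induction hypothesis to the
  integral over that line as a function of the other coordinates.\<close>

lemma nn_integral_PiM_lborel_eq_0I:
  assumes "finite J"
    and "f \<in> borel_measurable (PiM J (\<lambda>_. lborel :: real measure))"
    and "\<And>k::'j \<Rightarrow> int. (\<integral>\<^sup>+s. f (\<lambda>j\<in>J. s j + of_int (k j)) \<partial>PiM J (\<lambda>_. unif01)) = 0"
  shows "(\<integral>\<^sup>+s. f s \<partial>PiM J (\<lambda>_. lborel)) = 0"
  using assms
proof (induction J arbitrary: f rule: finite_induct)
  case empty
  then show ?case
    by (simp add: PiM_empty nn_integral_count_space_finite restrict_def)
next
  case (insert i J)
  note [measurable] = insert.prems(1)
  have ms: "sets (PiM J (\<lambda>_. lborel :: real measure)) = sets (PiM J (\<lambda>_. unif01))" for J :: "'j set"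
    by (intro sets_PiM_cong) auto
  have "(\<integral>\<^sup>+s. f s \<partial>PiM (insert i J) (\<lambda>_. lborel)) =
      (\<integral>\<^sup>+s. \<integral>\<^sup>+y. f (s(i := y)) \<partial>lborel \<partial>PiM J (\<lambda>_. lborel))"
    using insert.hyps by (simp add: L.product_nn_integral_insert)
  also have "\<dots> = 0"
  proof (rule insert.IH)
    show "(\<lambda>s. \<integral>\<^sup>+y. f (s(i := y)) \<partial>lborel) \<in> borel_measurable (PiM J (\<lambda>_. lborel))"
      by measurable
    fix k :: "'j \<Rightarrow> int"
    have zero: "(\<integral>\<^sup>+s. \<integral>\<^sup>+y. f ((\<lambda>j\<in>J. s j + of_int (k j))(i := y + of_int l)) \<partial>unif01 \<partial>PiM J (\<lambda>_. unif01)) = 0"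
      for l :: int
    proof -
      have *: "(\<lambda>j\<in>J. s j + of_int (k j))(i := y + of_int l) =
         (\<lambda>j\<in>insert i J. (s(i := y)) j + of_int ((k(i := l)) j))" if "s \<in> space (PiM J (\<lambda>_. unif01))" for s y
        using insert.hyps by (auto simp: fun_eq_iff)
      have [measurable]: "(\<lambda>s. f (\<lambda>j\<in>insert i J. s j + of_int ((k(i := l)) j))) \<in> borel_measurable (PiM (insert i J) (\<lambda>_. unif01))"
        by measurable
      have "(\<integral>\<^sup>+s. \<integral>\<^sup>+y. f ((\<lambda>j\<in>J. s j + of_int (k j))(i := y + of_int l)) \<partial>unif01 \<partial>PiM J (\<lambda>_. unif01))
        = (\<integral>\<^sup>+s. \<integral>\<^sup>+y. f (\<lambda>j\<in>insert i J. (s(i := y)) j + of_int ((k(i := l)) j)) \<partial>unif01 \<partial>PiM J (\<lambda>_. unif01))"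
        by (intro nn_integral_cong) (simp only: *)
      also have "\<dots> = (\<integral>\<^sup>+s. f (\<lambda>j\<in>insert i J. s j + of_int ((k(i := l)) j)) \<partial>PiM (insert i J) (\<lambda>_. unif01))"
        using insert.hyps by (subst U.product_nn_integral_insert) auto
      also have "\<dots> = 0"
        by (rule insert.prems(2))
      finally show ?thesis .
    qed
    have "(\<integral>\<^sup>+s. \<integral>\<^sup>+y. f ((\<lambda>j\<in>J. s j + of_int (k j))(i := y)) \<partial>lborel \<partial>PiM J (\<lambda>_. unif01)) =
      (\<integral>\<^sup>+s. \<integral>\<^sup>+l. (\<integral>\<^sup>+y. f ((\<lambda>j\<in>J. s j + of_int (k j))(i := y + of_int l)) \<partial>unif01) \<partial>count_space (UNIV::int set) \<partial>PiM J (\<lambda>_. unif01))"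
      by (intro nn_integral_cong nn_integral_lborel_tiles) measurable
    also have "\<dots> = (\<integral>\<^sup>+l. (\<integral>\<^sup>+s. \<integral>\<^sup>+y. f ((\<lambda>j\<in>J. s j + of_int (k j))(i := y + of_int l)) \<partial>unif01 \<partial>PiM J (\<lambda>_. unif01)) \<partial>count_space (UNIV::int set))"
      by (rule nn_integral_count_space_nn_integral) auto
    also have "\<dots> = 0" by (simp add: zero)
    finally show "(\<integral>\<^sup>+s. \<integral>\<^sup>+y. f ((\<lambda>j\<in>J. s j + of_int (k j))(i := y)) \<partial>lborel \<partial>PiM J (\<lambda>_. unif01)) = 0" .
  qed
  finally show ?case .
qed

text \<open>Shifting s by an integer vector changes every pairing by an integer, so the exceptional
  set is periodic; being null in the unit cube, it is null everywhere.\<close>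

lemma AE_lborel_eventually_near_int:
  fixes r :: "('j \<Rightarrow> int) \<Rightarrow> real" and V :: "'j \<Rightarrow> int"
  assumes J: "finite J" "card J \<ge> 2" and \<eta>: "\<eta> > 0" and A: "0 < A" "A \<le> 1"
    and nz: "\<And>M m. M \<ge> 1 \<Longrightarrow> m \<in> int_box J V M \<Longrightarrow> \<exists>j\<in>J. m j \<noteq> 0"
    and \<tau>: "\<tau> = 1 / (real (card J) - 1) + \<eta>"
  shows "AE s in PiM J (\<lambda>_. lborel). eventually (\<lambda>k. \<exists>m\<in>int_box J V (scale \<tau> k).
    near_int (A / (2 ^ k * real (scale \<tau> k))) (r m) (pairing J s m)) sequentially"
proof -
  define G where "G s \<longleftrightarrow> eventually (\<lambda>k. \<exists>m\<in>int_box J V (scale \<tau> k).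
    near_int (A / (2 ^ k * real (scale \<tau> k))) (r m) (pairing J s m)) sequentially" for s
  have fin: "finite (int_box J V M)" for M using J by (simp add: finite_int_box)
  have [measurable]: "Measurable.pred (PiM J (\<lambda>_. lborel)) G"
    unfolding G_def eventually_sequentially using fin by measurable
  have [measurable]: "Measurable.pred (PiM J (\<lambda>_. unif01)) G"
    unfolding G_def eventually_sequentially using fin by measurable
  have inv: "G (\<lambda>j\<in>J. s j + of_int (k j)) \<longleftrightarrow> G s" for s and k :: "'j \<Rightarrow> int"
  proof -
    have "pairing J (\<lambda>j\<in>J. s j + of_int (k j)) m = pairing J s m + of_int (\<Sum>j\<in>J. k j * m j)" for m
      by (simp add: sum.distrib[symmetric] algebra_simps)
    then show ?thesis by (simp only: G_def near_int_add_of_int)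
  qed
  have "AE s in PiM J (\<lambda>_. unif01). G s"
    unfolding G_def by (rule AE_unif01_eventually_near_int[OF assms])
  then have "(\<integral>\<^sup>+s. indicator {s. \<not> G s} s \<partial>PiM J (\<lambda>_. unif01)) = (0::ennreal)"
    by (subst nn_integral_0_iff_AE) (auto simp: indicator_def)
  then have "(\<integral>\<^sup>+s. indicator {s. \<not> G s} s \<partial>PiM J (\<lambda>_. lborel)) = (0::ennreal)"
    using J by (intro nn_integral_PiM_lborel_eq_0I) (auto simp: inv indicator_def)
  then show ?thesis
    by (subst (asm) nn_integral_0_iff_AE) (auto simp: indicator_def G_def[symmetric])
qed

section \<open>Quadratic forms with small integer values\<close>

text \<open>Serves both coordinate changes below: t = 0 gives the scaling of a row, c = 1 the shear
  of the remaining entries. The proof substitutes one coordinate at a time.\<close>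

lemma nn_integral_PiM_lborel_affine:
  fixes c :: real
  assumes "finite J" and "c \<noteq> 0" and "f \<in> borel_measurable (PiM J (\<lambda>_. lborel :: real measure))"
  shows "(\<integral>\<^sup>+s. f s \<partial>PiM J (\<lambda>_. lborel)) =
    ennreal (\<bar>c\<bar> ^ card J) * (\<integral>\<^sup>+s. f (\<lambda>j\<in>J. t j + c * s j) \<partial>PiM J (\<lambda>_. lborel))"
  using assms(1,3)
proof (induction J arbitrary: f rule: finite_induct)
  case empty
  then show ?case
    by (simp add: PiM_empty nn_integral_count_space_finite restrict_def)
next
  case (insert i J)
  note [measurable] = insert.prems
  have *: "(\<lambda>j\<in>J. t j + c * s j)(i := t i + c * y) = (\<lambda>j\<in>insert i J. t j + c * (s(i := y)) j)" for s y
    using insert.hyps by (auto simp: fun_eq_iff)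
  have "(\<integral>\<^sup>+s. f s \<partial>PiM (insert i J) (\<lambda>_. lborel)) =
      (\<integral>\<^sup>+s. \<integral>\<^sup>+y. f (s(i := y)) \<partial>lborel \<partial>PiM J (\<lambda>_. lborel))"
    using insert.hyps by (simp add: L.product_nn_integral_insert)
  also have "\<dots> = (\<integral>\<^sup>+s. ennreal \<bar>c\<bar> * (\<integral>\<^sup>+y. f (s(i := t i + c * y)) \<partial>lborel) \<partial>PiM J (\<lambda>_. lborel))"
    using \<open>c \<noteq> 0\<close> by (intro nn_integral_cong nn_integral_real_affine) measurable
  also have "\<dots> = ennreal \<bar>c\<bar> * (\<integral>\<^sup>+s. \<integral>\<^sup>+y. f (s(i := t i + c * y)) \<partial>lborel \<partial>PiM J (\<lambda>_. lborel))"
    by (intro nn_integral_cmult) measurable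
  also have "(\<integral>\<^sup>+s. \<integral>\<^sup>+y. f (s(i := t i + c * y)) \<partial>lborel \<partial>PiM J (\<lambda>_. lborel)) =
     ennreal (\<bar>c\<bar> ^ card J) * (\<integral>\<^sup>+s. \<integral>\<^sup>+y. f ((\<lambda>j\<in>J. t j + c * s j)(i := t i + c * y)) \<partial>lborel \<partial>PiM J (\<lambda>_. lborel))"
    by (rule insert.IH) measurable
  also have "\<dots> = ennreal (\<bar>c\<bar> ^ card J) *
     (\<integral>\<^sup>+s. f (\<lambda>j\<in>insert i J. t j + c * s j) \<partial>PiM (insert i J) (\<lambda>_. lborel))"
    unfolding * using insert.hyps by (subst L.product_nn_integral_insert) auto
  finally have "(\<integral>\<^sup>+s. f s \<partial>PiM (insert i J) (\<lambda>_. lborel)) = ennreal \<bar>c\<bar> * (ennreal (\<bar>c\<bar> ^ card J) *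
     (\<integral>\<^sup>+s. f (\<lambda>j\<in>insert i J. t j + c * s j) \<partial>PiM (insert i J) (\<lambda>_. lborel)))" .
  moreover have "ennreal (\<bar>c\<bar> ^ card (insert i J)) = ennreal \<bar>c\<bar> * ennreal (\<bar>c\<bar> ^ card J)"
    using insert.hyps by (simp add: ennreal_mult)
  ultimately show ?case
    by (simp only: mult.assoc)
qed

section \<open>Values at integer points, and measurable versions of hypothesis and
  conclusion\<close>

abbreviation int_vec :: "('n \<Rightarrow> int) \<Rightarrow> real ^ 'n" where
  "int_vec m \<equiv> (\<chi> i. of_int (m i))"

lemma quad_form_sum: "quad_form Q x = (\<Sum>i\<in>UNIV. \<Sum>j\<in>UNIV. Q $ i $ j * x $ i * x $ j)"
  unfolding quad_form_def inner_vec_def matrix_vector_mult_def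
  by (simp add: sum_distrib_left algebra_simps)

text \<open>A positive value of a quadratic form persists on an open cone, hence on all integer points
  of the dilates of some unit cube.\<close>

lemma homogeneous_pos_int_box:
  fixes F :: "real ^ 'n \<Rightarrow> real"
  assumes cont: "continuous_on UNIV F" and hom: "\<And>t z. F (t *\<^sub>R z) = t\<^sup>2 * F z" and pos: "F u > 0"
  obtains V :: "'n \<Rightarrow> int" where
    "\<And>M m. M \<ge> (1::nat) \<Longrightarrow> (\<And>j. int M * V j \<le> m j \<and> m j \<le> int M * V j + int M) \<Longrightarrow> F (int_vec m) > 0"
proof -
  have "open {z. F z > 0}"
    using cont by (intro open_Collect_less continuous_intros)
  then obtain d where d: "d > 0" "\<And>z. dist z u < d \<Longrightarrow> F z > 0"
    using pos unfolding open_dist by blast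
  \<comment> \<open>The point m / (M N) will differ from u by at most 2 / N in each coordinate: 1 /
    N for rounding N u to \<open>V\<close> and 1 / N for the width of the box. Summed over the
    coordinates this has to stay below d.\<close>
  obtain N :: nat where N: "2 * real CARD('n) / d < real N"
    using reals_Archimedean2 by blast
  then have N0: "real N > 0"
    using d by (smt (verit) divide_nonneg_pos of_nat_0_le_iff)
  define V where "V j = \<lfloor>real N * u $ j\<rfloor>" for j
  have "F (int_vec m) > 0"
    if M: "M \<ge> 1" and m: "\<And>j. int M * V j \<le> m j \<and> m j \<le> int M * V j + int M" for M :: nat and m
  proof -
    define z where "z = (1 / (real M * real N)) *\<^sub>R int_vec m"
    have M0: "real M > 0" using M by simp
    have "\<bar>(z - u) $ j\<bar> \<le> 2 / real N" for j
    proof -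
      have "real M * real_of_int (V j) \<le> real_of_int (m j)" "real_of_int (m j) \<le> real M * real_of_int (V j) + real M"
        using m[of j] by (metis of_int_le_iff of_int_mult of_int_of_nat_eq of_int_add)+
      then have 1: "real_of_int (V j) \<le> real_of_int (m j) / real M" "real_of_int (m j) / real M \<le> real_of_int (V j) + 1"
        using M0 by (auto simp: field_simps)
      have 2: "real_of_int (V j) \<le> real N * u $ j" "real N * u $ j \<le> real_of_int (V j) + 1"
        unfolding V_def by linarith+
      have "\<bar>real_of_int (m j) / real M - real N * u $ j\<bar> \<le> 2"
        using 1 2 by linarith
      then have "\<bar>real_of_int (m j) / real M - real N * u $ j\<bar> / real N \<le> 2 / real N"
        using N0 by (intro divide_right_mono) auto
      moreover have "(z - u) $ j = (real_of_int (m j) / real M - real N * u $ j) / real N"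
        using M0 N0 by (simp add: z_def field_simps)
      ultimately show ?thesis using N0 by (simp add: abs_divide)
    qed
    then have "norm (z - u) \<le> (\<Sum>j\<in>(UNIV::'n set). 2 / real N)"
      by (intro order_trans[OF norm_le_l1_cart] sum_mono)
    also have "\<dots> < d" using N d N0 by (simp add: field_simps)
    finally have "F z > 0" using d by (simp add: dist_norm)
    moreover have "int_vec m = (real M * real N) *\<^sub>R z"
      using M0 N0 by (simp add: z_def vec_eq_iff)
    ultimately show ?thesis using M0 N0 by (simp only: hom) simp
  qed
  then show thesis by (rule that)
qed

text \<open>The witnesses are integer vectors and not real ones, so that this is a countable
  combination of Borel conditions.\<close>

definition indefinite_int :: "real ^ 'n ^ 'n \<Rightarrow> bool" where
  "indefinite_int Q \<longleftrightarrow> (\<exists>v. quad_form Q (int_vec v) > 0) \<and> (\<exists>w. quad_form Q (int_vec w) < 0)"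

text \<open>The desired conclusion at \<epsilon> = 2^(-k) only, with natural constants and the l^1
  norm: all quantifiers range over countable sets, which gives measurability.\<close>

definition small_values :: "real \<Rightarrow> real ^ 'n ^ 'n \<Rightarrow> bool" where
  "small_values \<tau> Q \<longleftrightarrow> (\<exists>c::nat. \<exists>K. \<forall>k\<ge>K. \<exists>x. x \<noteq> (\<lambda>_. 0) \<and>
     (\<Sum>i\<in>UNIV. \<bar>real_of_int (x i)\<bar>) \<le> real c * 2 powr (real k * \<tau>) \<and>
     \<bar>quad_form Q (int_vec x)\<bar> < 1 / 2 ^ k)"

lemma quad_form_measurable [measurable]: "(\<lambda>Q. quad_form Q x) \<in> borel_measurable borel"
  unfolding quad_form_def matrix_vector_mult_def inner_vec_def
  by (intro borel_measurable_continuous_onI continuous_intros)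

lemma indefinite_int_measurable [measurable]: "Measurable.pred borel (indefinite_int :: real ^ 'n ^ 'n \<Rightarrow> bool)"
  unfolding indefinite_int_def by measurable

lemma small_values_measurable [measurable]: "Measurable.pred borel (small_values \<tau> :: real ^ 'n ^ 'n \<Rightarrow> bool)"
  unfolding small_values_def by measurable

text \<open>The columns of \<open>P\<close> are real vectors with values of both signs. Each sign
  persists on an open cone, which contains integer points.\<close>

lemma has_signature_indefinite_int:
  fixes Q :: "real ^ 'n ^ 'n"
  assumes sig: "has_signature p q Q" and pq: "p \<ge> 1" "q \<ge> 1"
  shows "indefinite_int Q"
proof -
  obtain P :: "real ^ 'n ^ 'n" and d where
    P: "transpose P ** Q ** P = (\<chi> i j. if i = j then d i else 0)"
    and c: "card {i. d i > 0} = p" "card {i. d i < 0} = q"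
    using sig unfolding has_signature_def by blast
  have val: "quad_form Q (P *v axis i 1) = d i" for i
  proof -
    have "quad_form Q (P *v axis i 1) = axis i 1 \<bullet> ((transpose P ** Q ** P) *v axis i 1)"
      unfolding quad_form_def
      by (metis dot_lmul_matrix matrix_vector_mul_assoc vector_transpose_matrix transpose_transpose)
    also have "\<dots> = d i"
      unfolding P by (simp add: inner_axis' matrix_vector_mult_basis column_def)
    finally show ?thesis .
  qed
  have "{i. d i > 0} \<noteq> {}" "{i. d i < 0} \<noteq> {}"
    using c pq by (metis card.empty not_one_le_zero)+
  then obtain i j where ij: "quad_form Q (P *v axis i 1) > 0" "- quad_form Q (P *v axis j 1) > 0"
    by (auto simp: val)
  have cont: "continuous_on UNIV (quad_form Q)" "continuous_on UNIV (\<lambda>x. - quad_form Q x)"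
    unfolding quad_form_sum by (intro continuous_intros)+
  have hom: "quad_form Q (t *\<^sub>R z) = t\<^sup>2 * quad_form Q z" for t z
    by (simp add: quad_form_def matrix_vector_mult_scaleR power2_eq_square)
  obtain V :: "'n \<Rightarrow> int" where "\<And>M m. M \<ge> (1::nat) \<Longrightarrow> (\<And>j. int M * V j \<le> m j \<and> m j \<le> int M * V j + int M)
      \<Longrightarrow> quad_form Q (int_vec m) > 0"
    using homogeneous_pos_int_box[OF cont(1) hom ij(1)] by blast
  \<comment> \<open>The corner \<open>V\<close> itself belongs to the box with M = 1.\<close>
  from this[of 1 V] have 1: "quad_form Q (int_vec V) > 0" by simp
  obtain W :: "'n \<Rightarrow> int" where "\<And>M m. M \<ge> (1::nat) \<Longrightarrow> (\<And>j. int M * W j \<le> m j \<and> m j \<le> int M * W j + int M)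
      \<Longrightarrow> - quad_form Q (int_vec m) > 0"
    using homogeneous_pos_int_box[OF cont(2) _ ij(2)] hom by auto
  from this[of 1 W] have "quad_form Q (int_vec W) < 0" by simp
  with 1 show ?thesis unfolding indefinite_int_def by blast
qed

text \<open>A general \<epsilon> is rounded down to 2^(-k), with k the ceiling of log 2 (1 /
  \<epsilon>); this costs a factor 2^\<tau> in the norm.\<close>

lemma small_values_imp:
  fixes Q :: "real ^ 'n ^ 'n"
  assumes "small_values \<tau> Q" and \<tau>: "\<tau> > 0"
  shows "\<exists>c > 0. \<exists>\<epsilon>\<^sub>0 > 0. \<forall>\<epsilon>. 0 < \<epsilon> \<and> \<epsilon> < \<epsilon>\<^sub>0 \<longrightarrow>
      (\<exists>x :: real ^ 'n. x \<noteq> 0 \<and> (\<forall>i. x $ i \<in> \<int>) \<and>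
        norm x \<le> c * \<epsilon> powr (- \<tau>) \<and> \<bar>quad_form Q x\<bar> < \<epsilon>)"
proof -
  obtain c :: nat and K where cK: "\<And>k. k \<ge> K \<Longrightarrow> \<exists>x. x \<noteq> (\<lambda>_. 0) \<and>
     (\<Sum>i\<in>UNIV. \<bar>real_of_int (x i)\<bar>) \<le> real c * 2 powr (real k * \<tau>) \<and>
     \<bar>quad_form Q (int_vec x)\<bar> < 1 / 2 ^ k"
    using assms(1) unfolding small_values_def by blast
  \<comment> \<open>The summand 1 keeps the constant positive when c = 0; the power of 2 pays for
    the rounding of k.\<close>
  define c' where "c' = (real c + 1) * 2 powr \<tau>"
  have "\<exists>x :: real ^ 'n. x \<noteq> 0 \<and> (\<forall>i. x $ i \<in> \<int>) \<and>
        norm x \<le> c' * \<epsilon> powr (- \<tau>) \<and> \<bar>quad_form Q x\<bar> < \<epsilon>" if \<epsilon>: "0 < \<epsilon>" "\<epsilon> < 1 / 2 ^ K" for \<epsilon>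
  proof -
    define l where "l = log 2 (1 / \<epsilon>)"
    have \<epsilon>l: "1 / \<epsilon> = 2 powr l" using \<epsilon> by (simp add: l_def)
    have "2 powr real K < 2 powr l"
      using \<epsilon> by (simp add: \<epsilon>l[symmetric] powr_realpow field_simps)
    then have lK: "real K < l" by simp
    define k where "k = nat \<lceil>l\<rceil>"
    have k: "real k \<ge> l" "real k \<le> l + 1" "k \<ge> K"
      using lK unfolding k_def by linarith+
    obtain x where x: "x \<noteq> (\<lambda>_. 0)" "(\<Sum>i\<in>UNIV. \<bar>real_of_int (x i)\<bar>) \<le> real c * 2 powr (real k * \<tau>)"
     "\<bar>quad_form Q (int_vec x)\<bar> < 1 / 2 ^ k"
      using cK[OF k(3)] by blast
    have "norm (int_vec x) \<le> (\<Sum>i\<in>UNIV. \<bar>real_of_int (x i)\<bar>)"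
      using norm_le_l1_cart[of "int_vec x"] by simp
    also have "\<dots> \<le> (real c + 1) * 2 powr (real k * \<tau>)"
      using x(2) by (simp add: distrib_right add_increasing2)
    also have "\<dots> \<le> (real c + 1) * 2 powr ((l + 1) * \<tau>)"
      using k \<tau> by (intro mult_left_mono powr_mono mult_right_mono) auto
    also have "\<dots> = c' * (2 powr l) powr \<tau>"
      by (simp add: c'_def powr_powr powr_add[symmetric] algebra_simps)
    also have "(2 powr l) powr \<tau> = \<epsilon> powr (- \<tau>)"
      using \<epsilon> by (simp add: \<epsilon>l[symmetric] powr_divide powr_minus_divide)
    finally have 1: "norm (int_vec x) \<le> c' * \<epsilon> powr (- \<tau>)" .
    have "1 / \<epsilon> \<le> 2 ^ k"
      using k by (simp add: \<epsilon>l powr_realpow[symmetric])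
    then have "1 / 2 ^ k \<le> \<epsilon>"
      using \<epsilon> by (simp add: field_simps)
    then have "\<bar>quad_form Q (int_vec x)\<bar> < \<epsilon>" using x(3) by simp
    moreover have "int_vec x \<noteq> 0" using x(1) by (auto simp: vec_eq_iff fun_eq_iff)
    ultimately show ?thesis using 1 by (intro exI[of _ "int_vec x"]) auto
  qed
  moreover have "c' > 0" by (auto simp: c'_def intro!: mult_pos_pos add_nonneg_pos)
  ultimately show ?thesis
    by (intro exI[of _ c'] conjI exI[of _ "1 / 2 ^ K"]) auto
qed

text \<open>The assumptions on the entries say that \<open>S s\<close> is the form \<alpha> (x + s .
  m)^2 + G(m), with \<alpha> and G fixed and s varying. There are n - 1 coordinates of s, so 1 /
  (|J| - 1) becomes 1 / (n - 2).\<close>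

lemma AE_small_values:
  fixes o' :: "'n::finite" and S :: "('n set \<Rightarrow> real) \<Rightarrow> real ^ 'n ^ 'n" and y :: "'n \<Rightarrow> 'n \<Rightarrow> real"
  assumes n: "CARD('n) \<ge> 3" and \<alpha>: "\<alpha> \<noteq> 0" and \<eta>: "\<eta> > 0"
    and \<tau>: "\<tau> = 1 / (real CARD('n) - 2) + \<eta>"
    and S1: "\<And>s. S s $ o' $ o' = \<alpha>"
    and S2: "\<And>s j. j \<noteq> o' \<Longrightarrow> S s $ o' $ j = \<alpha> * s {o', j}"
    and S3: "\<And>s j. j \<noteq> o' \<Longrightarrow> S s $ j $ o' = \<alpha> * s {o', j}"
    and S4: "\<And>s i j. i \<noteq> o' \<Longrightarrow> j \<noteq> o' \<Longrightarrow> S s $ i $ j = y i j + \<alpha> * s {o', i} * s {o', j}"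
  shows "AE s in PiM ((\<lambda>j. {o', j}) ` (UNIV - {o'})) (\<lambda>_. lborel). indefinite_int (S s) \<longrightarrow> small_values \<tau> (S s)"
proof -
  define N where "N = UNIV - {o'}"
  define J where "J = (\<lambda>j. {o', j}) ` N"
  have inj: "inj_on (\<lambda>j. {o', j}) N"
    by (auto simp: inj_on_def N_def doubleton_eq_iff)
  have finJ: "finite J" by (simp add: J_def)
  have cN: "real (card N) = real CARD('n) - 1" "card N \<ge> 2"
    using n by (auto simp: N_def card_Diff_singleton)
  have cJ: "card J = card N"
    unfolding J_def by (rule card_image[OF inj])
  define G where "G z = (\<Sum>i\<in>N. \<Sum>j\<in>N. y i j * z $ i * z $ j)" for z :: "real ^ 'n"
  have split: "(\<Sum>i\<in>UNIV. g i) = g o' + (\<Sum>i\<in>N. g i)" for g :: "'n \<Rightarrow> real"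
    unfolding N_def by (rule sum.remove) auto
  have val: "quad_form (S s) z = \<alpha> * (z $ o' + (\<Sum>j\<in>N. s {o', j} * z $ j))\<^sup>2 + G z" for s z
  proof -
    define T where "T = (\<Sum>j\<in>N. s {o', j} * z $ j)"
    have 1: "(\<Sum>j\<in>N. S s $ o' $ j * z $ o' * z $ j) = \<alpha> * z $ o' * T"
      unfolding T_def sum_distrib_left by (intro sum.cong) (auto simp: S2 N_def)
    have 2: "(\<Sum>i\<in>N. S s $ i $ o' * z $ i * z $ o') = \<alpha> * z $ o' * T"
      unfolding T_def sum_distrib_left by (intro sum.cong) (auto simp: S3 N_def)
    have "(\<Sum>i\<in>N. \<Sum>j\<in>N. S s $ i $ j * z $ i * z $ j)
      = (\<Sum>i\<in>N. \<Sum>j\<in>N. y i j * z $ i * z $ j + \<alpha> * ((s {o', i} * z $ i) * (s {o', j} * z $ j)))"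
      by (intro sum.cong) (auto simp: S4 N_def algebra_simps)
    also have "\<dots> = G z + \<alpha> * (T * T)"
      unfolding T_def sum_product G_def by (simp add: sum.distrib sum_distrib_left)
    finally have 3: "(\<Sum>i\<in>N. \<Sum>j\<in>N. S s $ i $ j * z $ i * z $ j) = G z + \<alpha> * (T * T)" .
    have "quad_form (S s) z = \<alpha> * z $ o' * z $ o' + \<alpha> * z $ o' * T + (\<alpha> * z $ o' * T + (G z + \<alpha> * (T * T)))"
      by (simp only: quad_form_sum split sum.distrib 1 2 3 S1)
    then show ?thesis
      unfolding T_def[symmetric] by (simp add: power2_eq_square algebra_simps)
  qed
  show ?thesis
  proof (cases "\<exists>v::'n \<Rightarrow> int. - G (int_vec v) / \<alpha> > 0")
    \<comment> \<open>Here G has weakly the sign of \<alpha> at all integer points, and so has the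
      whole form; it is not indefinite there, and the implication is vacuous.\<close>
    case False
    have "\<not> indefinite_int (S s)" for s
    proof
      assume "indefinite_int (S s)"
      then obtain v w where vw: "quad_form (S s) (int_vec v) > 0" "quad_form (S s) (int_vec w) < 0"
        by (auto simp: indefinite_int_def)
      show False
      proof (cases "\<alpha> > 0")
        case True
        then have "\<alpha> * (int_vec w $ o' + (\<Sum>j\<in>N. s {o', j} * int_vec w $ j))\<^sup>2 \<ge> 0" by simp
        then have "G (int_vec w) < 0" using vw(2) unfolding val by linarith
        then show False using False True by (auto simp: field_simps)
      next
        case c: False
        then have "\<alpha> * (int_vec v $ o' + (\<Sum>j\<in>N. s {o', j} * int_vec v $ j))\<^sup>2 \<le> 0"
          by (simp add: mult_nonpos_nonneg)
        then have "G (int_vec v) > 0" using vw(1) unfolding val by linarith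
        then show False using False c \<alpha> by (auto simp: field_simps not_less dest!: spec[of _ v])
      qed
    qed
    then show ?thesis by simp
  next
    case True
    then obtain u :: "'n \<Rightarrow> int" where u: "- G (int_vec u) / \<alpha> > 0" by blast
    define F where "F z = - G z / \<alpha>" for z
    have cont: "continuous_on UNIV F"
      unfolding F_def G_def using \<alpha> by (intro continuous_intros) auto
    have hom: "F (t *\<^sub>R z) = t\<^sup>2 * F z" for t z
      by (simp add: F_def G_def sum_distrib_left power2_eq_square mult_ac)
    obtain V :: "'n \<Rightarrow> int" where V: "\<And>M m. M \<ge> (1::nat) \<Longrightarrow>
       (\<And>j. int M * V j \<le> m j \<and> m j \<le> int M * V j + int M) \<Longrightarrow> F (int_vec m) > 0"
      using homogeneous_pos_int_box[OF cont hom u[folded F_def]] by blast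
    \<comment> \<open>The coordinates of s are indexed by the pairs {o', j}, so the corner
      \<open>V\<close> is reindexed along j -> {o', j}.\<close>
    define V' where "V' p = V (the_inv_into N (\<lambda>j. {o', j}) p)" for p
    have V': "V' {o', j} = V j" if "j \<in> N" for j
      using the_inv_into_f_f[OF inj that] by (simp add: V'_def)
    \<comment> \<open>The integer point with component t at \<open>o'\<close> and the others from m.
      As G does not see the component at \<open>o'\<close>, positivity of F for one t inside the box
      of \<open>V\<close> gives it for all t.\<close>
    define ext where "ext t m = (\<lambda>i. if i = o' then t else m {o', i})" for t :: int and m :: "'n set \<Rightarrow> int"
    have Fext: "F (int_vec (ext t m)) = F (int_vec (ext t' m))" for t t' m
      unfolding F_def G_def ext_def by (intro arg_cong2[where f="(/)"] arg_cong[where f=uminus] sum.cong)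
        (auto simp: N_def)
    have Fpos: "F (int_vec (ext t m)) > 0" if "M \<ge> 1" "m \<in> int_box J V' M" for t m M
    proof -
      have "int M * V j \<le> ext (int M * V o') m j \<and> ext (int M * V o') m j \<le> int M * V j + int M" for j
      proof (cases "j = o'")
        case False
        then have "j \<in> N" by (simp add: N_def)
        then have "{o', j} \<in> J" by (simp add: J_def)
        then have "m {o', j} \<in> {int M * V' {o', j}..int M * V' {o', j} + int M}"
          using that(2) unfolding int_box_def by (rule PiE_mem[rotated])
        then show ?thesis using False V'[OF \<open>j \<in> N\<close>] by (simp add: ext_def)
      qed (simp add: ext_def)
      then have "F (int_vec (ext (int M * V o') m)) > 0"
        using V[OF that(1)] by blast
      then show ?thesis by (simp add: Fext[of t m "int M * V o'"])
    qed
    have nz: "\<exists>j\<in>J. m j \<noteq> 0" if "M \<ge> 1" "m \<in> int_box J V' M" for m M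
    proof (rule ccontr)
      assume "\<not> (\<exists>j\<in>J. m j \<noteq> 0)"
      then have "m {o', j} = 0" if "j \<in> N" for j
        using that by (auto simp: J_def)
      then have "F (int_vec (ext 0 m)) = 0"
        by (simp add: F_def G_def ext_def N_def)
      then show False using Fpos[OF that, of 0] by simp
    qed
    define c where "c = nat (\<Sum>i\<in>J. \<bar>V' i\<bar> + 1)"
    define C where "C = real c"
    have C0: "C \<ge> 0" by (simp add: C_def)
    have mC: "\<bar>real_of_int (m {o', j})\<bar> \<le> C * real M" if "m \<in> int_box J V' M" "j \<in> N" for m M j
    proof -
      have "\<bar>m {o', j}\<bar> \<le> int (c * M)"
        unfolding c_def using that by (intro int_box_abs_le finJ) (auto simp: J_def)
      then have "real_of_int \<bar>m {o', j}\<bar> \<le> real_of_int (int (c * M))"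
        by (simp only: of_int_le_iff)
      then show ?thesis by (simp add: C_def)
    qed
    \<comment> \<open>On the box the coordinates are at most C M, so F is at most B (C M)^2 and its
      square root r at most R M.\<close>
    define B where "B = (\<Sum>i\<in>N. \<Sum>j\<in>N. \<bar>y i j\<bar>) / \<bar>\<alpha>\<bar>"
    have B0: "B \<ge> 0" by (auto simp: B_def intro!: sum_nonneg divide_nonneg_nonneg)
    define R where "R = sqrt B * C"
    have R0: "R \<ge> 0" using B0 C0 by (simp add: R_def)
    define r where "r m = sqrt (F (int_vec (ext 0 m)))" for m
    have rle: "r m \<le> R * real M" if "m \<in> int_box J V' M" for m M
    proof -
      have "\<bar>G (int_vec (ext 0 m))\<bar> \<le> (\<Sum>i\<in>N. \<Sum>j\<in>N. \<bar>y i j\<bar> * ((C * real M) * (C * real M)))"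
        unfolding G_def
      proof (intro order_trans[OF sum_abs] sum_mono)
        fix i j assume "i \<in> N" "j \<in> N"
        then have "\<bar>int_vec (ext 0 m) $ i\<bar> \<le> C * real M" "\<bar>int_vec (ext 0 m) $ j\<bar> \<le> C * real M"
          using mC[OF that] by (auto simp: ext_def N_def)
        then have "\<bar>y i j\<bar> * (\<bar>int_vec (ext 0 m) $ i\<bar> * \<bar>int_vec (ext 0 m) $ j\<bar>) \<le> \<bar>y i j\<bar> * ((C * real M) * (C * real M))"
          using C0 by (intro mult_left_mono mult_mono) auto
        then show "\<bar>y i j * int_vec (ext 0 m) $ i * int_vec (ext 0 m) $ j\<bar> \<le> \<bar>y i j\<bar> * ((C * real M) * (C * real M))"
          by (simp only: abs_mult mult.assoc)
      qed
      also have "\<dots> = (\<Sum>i\<in>N. \<Sum>j\<in>N. \<bar>y i j\<bar>) * ((C * real M) * (C * real M))"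
        by (simp only: sum_distrib_right)
      also have "(\<Sum>i\<in>N. \<Sum>j\<in>N. \<bar>y i j\<bar>) = B * \<bar>\<alpha>\<bar>"
        using \<alpha> by (simp add: B_def)
      also have "B * \<bar>\<alpha>\<bar> * ((C * real M) * (C * real M)) = (B * (C * real M)\<^sup>2) * \<bar>\<alpha>\<bar>"
        by (simp add: power2_eq_square)
      finally have "\<bar>F (int_vec (ext 0 m))\<bar> \<le> B * (C * real M)\<^sup>2"
        using \<alpha> by (simp add: F_def abs_divide pos_divide_le_eq)
      then have "r m \<le> sqrt (B * (C * real M)\<^sup>2)"
        unfolding r_def by (intro real_sqrt_le_mono) simp
      also have "\<dots> = R * real M"
        using C0 by (simp add: R_def real_sqrt_mult)
      finally show ?thesis .
    qed
    \<comment> \<open>The final value will be \<alpha> \<theta> (2 r + \<theta>) with |\<theta>| < A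
      / (2^k M) and |2 r + \<theta>| <= (2 R + 1) M; this A puts it below 2^(-k). The minimum with 1
      ensures \<psi> <= 1.\<close>
    define A where "A = min 1 (1 / (\<bar>\<alpha>\<bar> * (2 * R + 1)))"
    have A: "0 < A" "A \<le> 1" "A * (\<bar>\<alpha>\<bar> * (2 * R + 1)) \<le> 1"
    proof -
      have pos: "\<bar>\<alpha>\<bar> * (2 * R + 1) > 0" using \<alpha> R0 by simp
      then show "0 < A" "A \<le> 1" by (auto simp: A_def)
      have "A \<le> 1 / (\<bar>\<alpha>\<bar> * (2 * R + 1))" by (simp add: A_def)
      then show "A * (\<bar>\<alpha>\<bar> * (2 * R + 1)) \<le> 1"
        using pos by (simp only: pos_le_divide_eq)
    qed
    have \<tau>0: "\<tau> > 0" using \<tau> \<eta> n by (auto intro!: add_nonneg_pos)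
    have \<tau>': "\<tau> = 1 / (real (card J) - 1) + \<eta>"
      using cN by (simp add: \<tau> cJ)
    have "AE s in PiM J (\<lambda>_. lborel). eventually (\<lambda>k. \<exists>m\<in>int_box J V' (scale \<tau> k).
      near_int (A / (2 ^ k * real (scale \<tau> k))) (r m) (pairing J s m)) sequentially"
      using cN cJ by (intro AE_lborel_eventually_near_int[OF finJ _ \<eta> A(1,2) nz \<tau>']) auto
    then have "AE s in PiM J (\<lambda>_. lborel). small_values \<tau> (S s)"
    proof eventually_elim
      case (elim s)
      \<comment> \<open>Bounds the l^1 norm of x relative to M: the first three terms are for the
        component t at \<open>o'\<close>, the last one for all others. It depends on s but not on
        k.\<close>
      define D where "D = 1 + R + (\<Sum>p\<in>J. \<bar>s p\<bar>) * C + real (card N) * C"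
      have D0: "D \<ge> 0" using R0 C0 by (auto simp: D_def intro!: add_nonneg_nonneg mult_nonneg_nonneg sum_nonneg)
      have "\<exists>x. x \<noteq> (\<lambda>_. 0) \<and> (\<Sum>i\<in>UNIV. \<bar>real_of_int (x i)\<bar>) \<le> real (nat \<lceil>2 * D\<rceil>) * 2 powr (real k * \<tau>) \<and>
          \<bar>quad_form (S s) (int_vec x)\<bar> < 1 / 2 ^ k"
        if ex: "\<exists>m\<in>int_box J V' (scale \<tau> k).
          near_int (A / (2 ^ k * real (scale \<tau> k))) (r m) (pairing J s m)" for k
      proof -
        define M where "M = scale \<tau> k"
        define \<psi> where "\<psi> = A / (2 ^ k * real M)"
        have M: "M \<ge> 1" "real M \<ge> 1" "real M \<le> 2 * 2 powr (real k * \<tau>)"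
          using scale_bounds[OF \<tau>0, of k] by (auto simp: M_def)
        have \<psi>: "0 < \<psi>" "\<psi> \<le> 1" "\<psi> * real M = A / 2 ^ k"
        proof -
          have "1 * 1 \<le> 2 ^ k * real M" using M by (intro mult_mono) auto
          then show "0 < \<psi>" "\<psi> \<le> 1" "\<psi> * real M = A / 2 ^ k"
            using A M by (auto simp: \<psi>_def field_simps)
        qed
        obtain m t where m: "m \<in> int_box J V' M" and t: "\<bar>of_int t + pairing J s m - r m\<bar> < \<psi>"
          using ex unfolding near_int_def M_def \<psi>_def by blast
        define P where "P = pairing J s m"
        define x where "x = ext t m"
        have xN: "x j = m {o', j}" if "j \<in> N" for j
          using that by (simp add: x_def ext_def N_def)
        have xo: "x o' = t" by (simp add: x_def ext_def)
        have P: "(\<Sum>j\<in>N. s {o', j} * int_vec x $ j) = P"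
          unfolding P_def J_def by (simp add: sum.reindex[OF inj] xN cong: sum.cong)
        have r2: "G (int_vec x) = - \<alpha> * (r m)\<^sup>2" and Fx: "F (int_vec x) > 0"
        proof -
          show F: "F (int_vec x) > 0" unfolding x_def by (rule Fpos[OF M(1) m])
          have "F (int_vec x) = F (int_vec (ext 0 m))"
            unfolding x_def by (rule Fext)
          then have "(r m)\<^sup>2 = F (int_vec x)" using F by (simp add: r_def)
          then show "G (int_vec x) = - \<alpha> * (r m)\<^sup>2" using \<alpha> by (simp add: F_def)
        qed
        have r0: "r m \<ge> 0" using Fpos[OF M(1) m, of 0] by (simp add: r_def)
        define \<theta> where "\<theta> = of_int t + P - r m"
        have \<theta>: "\<bar>\<theta>\<bar> < \<psi>" using t by (simp add: \<theta>_def P_def)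
        \<comment> \<open>As G = -\<alpha> r^2 at this point, the value is \<alpha> times a
          difference of squares of r + \<theta> and r, which has the small factor \<theta>.\<close>
        have q: "quad_form (S s) (int_vec x) = \<alpha> * (\<theta> * (2 * r m + \<theta>))"
        proof -
          have "of_int t + P = r m + \<theta>" by (simp add: \<theta>_def)
          then have "quad_form (S s) (int_vec x) = \<alpha> * (r m + \<theta>)\<^sup>2 - \<alpha> * (r m)\<^sup>2"
            unfolding val P by (simp add: xo r2)
          then show ?thesis by (simp add: power2_eq_square algebra_simps)
        qed
        have "\<bar>2 * r m + \<theta>\<bar> \<le> (2 * R + 1) * real M"
        proof -
          have "\<bar>2 * r m + \<theta>\<bar> \<le> 2 * (R * real M) + 1" using r0 rle[OF m] \<theta> \<psi> by linarith
          also have "\<dots> \<le> (2 * R + 1) * real M" using M by (simp add: algebra_simps)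
          finally show ?thesis .
        qed
        then have "\<bar>quad_form (S s) (int_vec x)\<bar> \<le> \<bar>\<alpha>\<bar> * (\<bar>\<theta>\<bar> * ((2 * R + 1) * real M))"
          unfolding q abs_mult by (intro mult_left_mono) auto
        also have "\<dots> < \<bar>\<alpha>\<bar> * (\<psi> * ((2 * R + 1) * real M))"
          using \<theta> \<alpha> R0 M by (intro mult_strict_left_mono mult_strict_right_mono) auto
        also have "\<dots> = (\<psi> * real M) * (\<bar>\<alpha>\<bar> * (2 * R + 1))" by (simp add: algebra_simps)
        also have "\<dots> = A * (\<bar>\<alpha>\<bar> * (2 * R + 1)) / 2 ^ k" unfolding \<psi>(3) by simp
        also have "\<dots> \<le> 1 / 2 ^ k" using A(3) by (intro divide_right_mono) auto
        finally have small: "\<bar>quad_form (S s) (int_vec x)\<bar> < 1 / 2 ^ k" .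
        have "\<bar>P\<bar> \<le> (\<Sum>p\<in>J. \<bar>s p\<bar> * (C * real M))"
          unfolding P_def
        proof (intro order_trans[OF sum_abs] sum_mono)
          fix p assume "p \<in> J"
          then obtain j where "j \<in> N" "p = {o', j}" by (auto simp: J_def)
          then show "\<bar>s p * real_of_int (m p)\<bar> \<le> \<bar>s p\<bar> * (C * real M)"
            unfolding abs_mult using mC[OF m \<open>j \<in> N\<close>] by (intro mult_left_mono) auto
        qed
        also have "\<dots> = (\<Sum>p\<in>J. \<bar>s p\<bar>) * C * real M"
          by (simp add: sum_distrib_right mult.assoc)
        finally have Pb: "\<bar>P\<bar> \<le> (\<Sum>p\<in>J. \<bar>s p\<bar>) * C * real M" .
        have "\<bar>real_of_int t\<bar> \<le> \<psi> + r m + \<bar>P\<bar>" using \<theta> r0 unfolding \<theta>_def by linarith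
        also have "\<dots> \<le> 1 * real M + R * real M + (\<Sum>p\<in>J. \<bar>s p\<bar>) * C * real M"
          using \<psi> M rle[OF m] Pb by linarith
        finally have tb: "\<bar>real_of_int t\<bar> \<le> 1 * real M + R * real M + (\<Sum>p\<in>J. \<bar>s p\<bar>) * C * real M" .
        have "(\<Sum>i\<in>N. \<bar>real_of_int (x i)\<bar>) \<le> (\<Sum>i\<in>N. C * real M)"
          by (intro sum_mono) (simp add: xN mC[OF m])
        then have "(\<Sum>i\<in>UNIV. \<bar>real_of_int (x i)\<bar>) \<le> D * real M"
          using tb by (simp add: split xo D_def algebra_simps)
        also have "\<dots> \<le> D * (2 * 2 powr (real k * \<tau>))"
          using M D0 by (intro mult_left_mono)
        also have "\<dots> = (2 * D) * 2 powr (real k * \<tau>)" by simp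
        also have "\<dots> \<le> real (nat \<lceil>2 * D\<rceil>) * 2 powr (real k * \<tau>)"
          by (intro mult_right_mono real_nat_ceiling_ge) auto
        finally have nb: "(\<Sum>i\<in>UNIV. \<bar>real_of_int (x i)\<bar>) \<le> real (nat \<lceil>2 * D\<rceil>) * 2 powr (real k * \<tau>)" .
        have "x \<noteq> (\<lambda>_. 0)"
        proof
          assume "x = (\<lambda>_. 0)"
          then have "F (int_vec x) = 0" by (simp add: F_def G_def)
          then show False using Fx by simp
        qed
        then show ?thesis using nb small by blast
      qed
      then show ?case
        using elim unfolding small_values_def eventually_sequentially by blast
    qed
    then show ?thesis
      unfolding J_def N_def by eventually_elim simp
  qed
qed

text \<open>The rank-one term of the completed square. Coordinates are indexed by unordered pairs,
  so an ordering has to be chosen; the product is symmetric and does not depend on it.\<close>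

definition pair_prod :: "'n \<Rightarrow> ('n set \<Rightarrow> real) \<Rightarrow> 'n set \<Rightarrow> real" where
  "pair_prod o' s p = (let ij = SOME ij. p = {fst ij, snd ij} in s {o', fst ij} * s {o', snd ij})"

lemma pair_prod: "pair_prod o' s {i, j} = s {o', i} * s {o', j}"
proof -
  define ij where "ij = (SOME ij. {i, j} = {fst ij, snd ij})"
  have "{i, j} = {fst ij, snd ij}"
    unfolding ij_def by (rule someI[of "\<lambda>ij. {i, j} = {fst ij, snd ij}" "(i, j)"]) simp
  then show ?thesis
    unfolding pair_prod_def Let_def ij_def[symmetric] by (auto simp: doubleton_eq_iff)
qed

text \<open>The coordinates split into the diagonal entry \<alpha> at \<open>o'\<close>, the rest of
  its row (\<open>J\<close>) and the remaining block (\<open>L\<close>). For fixed \<alpha> \<noteq>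
  0, shearing the block by x_i x_j / \<alpha> and scaling the row x by \<alpha> leads to the
  parameters of \<open>AE_small_values\<close>.\<close>

lemma AE_sym_coordinates_small_values:
  assumes n: "CARD('n::finite) \<ge> 3" and \<eta>: "\<eta> > 0"
    and \<tau>: "\<tau> = 1 / (real CARD('n) - 2) + \<eta>"
  shows "AE a in PiM (index_pairs :: 'n set set) (\<lambda>_. lborel).
    indefinite_int (sym_matrix_of a) \<longrightarrow> small_values \<tau> (sym_matrix_of a :: real ^ 'n ^ 'n)"
proof -
  \<comment> \<open>Any index serves; \<open>undefined\<close> merely names some element of the
    type.\<close>
  define o' :: 'n where "o' = undefined"
  define N where "N = UNIV - {o'}"
  define J where "J = (\<lambda>j. {o', j}) ` N"
  define L where "L = {{i, j} | i j. i \<in> N \<and> j \<in> N}"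
  have fin: "finite J" "finite L" by auto
  have memJ: "o' \<in> p" "p \<noteq> {o'}" if "p \<in> J" for p
    using that by (auto simp: J_def N_def)
  have memL: "o' \<notin> p" if "p \<in> L" for p
    using that by (auto simp: L_def N_def)
  have disj: "J \<inter> L = {}" "{o'} \<notin> J \<union> L" "{o'} \<notin> J"
    using memJ memL by blast+
  have pairI: "{i, j} \<in> index_pairs" for i j :: 'n
    unfolding index_pairs_def by blast
  have I: "index_pairs = insert {o'} (J \<union> L)"
  proof (intro equalityI subsetI)
    fix p :: "'n set" assume "p \<in> index_pairs"
    then obtain i j where p: "p = {i, j}" by (auto simp: index_pairs_def)
    consider "i = o'" "j = o'" | "i = o'" "j \<in> N" | "j = o'" "i \<in> N" | "i \<in> N" "j \<in> N"
      unfolding N_def by blast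
    then show "p \<in> insert {o'} (J \<union> L)"
    proof cases
      case 3
      then have "p = {o', i}" using p by blast
      then show ?thesis using 3 unfolding J_def by blast
    next
      case 4
      then show ?thesis unfolding p L_def by blast
    qed (auto simp: p J_def)
  next
    fix p assume "p \<in> insert {o'} (J \<union> L)"
    then consider "p = {o', o'}" | j where "p = {o', j}" | i j where "p = {i, j}"
      unfolding J_def L_def by blast
    then show "p \<in> index_pairs" by cases (simp_all only: pairI)
  qed
  define T where "T Q \<longleftrightarrow> (indefinite_int Q \<longrightarrow> small_values \<tau> Q)" for Q :: "real ^ 'n ^ 'n"
  have [measurable]: "Measurable.pred borel T"
    unfolding T_def by measurable
  have [measurable]: "sym_matrix_of \<in> measurable (PiM (insert {o'} (J \<union> L)) (\<lambda>_. lborel)) (borel :: (real ^ 'n ^ 'n) measure)"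
    using sym_matrix_of_measurable[where 'n='n] unfolding I by (simp add: measurable_restrict_space2_iff)
  define f :: "('n set \<Rightarrow> real) \<Rightarrow> ennreal" where "f a = indicator {Q. \<not> T Q} (sym_matrix_of a)" for a
  have [measurable]: "f \<in> borel_measurable (PiM (insert {o'} (J \<union> L)) (\<lambda>_. lborel))"
    unfolding f_def by measurable
  have zero: "(\<integral>\<^sup>+z. f (z({o'} := \<alpha>)) \<partial>PiM (J \<union> L) (\<lambda>_. lborel)) = 0" if \<alpha>: "\<alpha> \<noteq> 0" for \<alpha>
  proof -
    let ?PJ = "PiM J (\<lambda>_. lborel :: real measure)" and ?PL = "PiM L (\<lambda>_. lborel :: real measure)"
    \<comment> \<open>The coordinates expressed by the row x and the coefficients y of G. The factor
      1 matches the shape of \<open>nn_integral_PiM_lborel_affine\<close> with c = 1.\<close>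
    define \<Phi> where "\<Phi> x y = (\<lambda>p\<in>insert {o'} (J \<union> L). if p = {o'} then \<alpha> else if p \<in> J then x p
       else pair_prod o' x p / \<alpha> + 1 * y p)" for x y :: "'n set \<Rightarrow> real"
    have comp: "(\<lambda>z. pair_prod o' (fst z) p) \<in> borel_measurable (?PJ \<Otimes>\<^sub>M ?PL)" if "p \<in> L" for p
    proof -
      from that obtain i j where ij: "i \<in> N" "j \<in> N" "p = {i, j}" by (auto simp: L_def)
      then have [measurable]: "{o', i} \<in> J" "{o', j} \<in> J" by (auto simp: J_def)
      show ?thesis unfolding ij(3) pair_prod by measurable
    qed
    have \<Phi>m [measurable]: "(\<lambda>z. \<Phi> (fst z) (snd z)) \<in> measurable (?PJ \<Otimes>\<^sub>M ?PL) (PiM (insert {o'} (J \<union> L)) (\<lambda>_. lborel))"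
      unfolding \<Phi>_def
    proof (rule measurable_restrict)
      fix p assume "p \<in> insert {o'} (J \<union> L)"
      then consider "p = {o'}" | "p \<noteq> {o'}" "p \<in> J" | "p \<noteq> {o'}" "p \<notin> J" "p \<in> L" by blast
      then show "(\<lambda>z. if p = {o'} then \<alpha> else if p \<in> J then fst z p else pair_prod o' (fst z) p / \<alpha> + 1 * snd z p)
          \<in> measurable (?PJ \<Otimes>\<^sub>M ?PL) lborel"
      proof cases
        case 3
        note comp[OF 3(3), measurable]
        show ?thesis using 3 by simp
      qed simp_all
    qed
    have hm [measurable]: "case_prod (\<lambda>x y. f (\<Phi> x y)) \<in> borel_measurable (?PJ \<Otimes>\<^sub>M ?PL)"
      unfolding case_prod_unfold by measurable
    have [measurable]: "(\<lambda>z. f (z({o'} := \<alpha>))) \<in> borel_measurable (PiM (J \<union> L) (\<lambda>_. lborel))"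
      by measurable
    have "(\<integral>\<^sup>+z. f (z({o'} := \<alpha>)) \<partial>PiM (J \<union> L) (\<lambda>_. lborel))
       = (\<integral>\<^sup>+x. \<integral>\<^sup>+y. f ((merge J L (x, y))({o'} := \<alpha>)) \<partial>?PL \<partial>?PJ)"
      by (rule L.product_nn_integral_fold) (use disj fin in auto)
    also have "\<dots> = (\<integral>\<^sup>+x. \<integral>\<^sup>+y. f (\<Phi> x y) \<partial>?PL \<partial>?PJ)"
    proof (rule nn_integral_cong)
      fix x assume [measurable]: "x \<in> space ?PJ"
      have "(merge J L (x, \<lambda>p\<in>L. pair_prod o' x p / \<alpha> + 1 * y p))({o'} := \<alpha>) = \<Phi> x y" for y
        using disj by (auto simp: \<Phi>_def merge_def fun_eq_iff)
      moreover have "(\<integral>\<^sup>+y. f ((merge J L (x, y))({o'} := \<alpha>)) \<partial>?PL) = ennreal (\<bar>1\<bar> ^ card L) *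
          (\<integral>\<^sup>+y. f ((merge J L (x, \<lambda>p\<in>L. pair_prod o' x p / \<alpha> + 1 * y p))({o'} := \<alpha>)) \<partial>?PL)"
        using fin by (intro nn_integral_PiM_lborel_affine) measurable
      ultimately show "(\<integral>\<^sup>+y. f ((merge J L (x, y))({o'} := \<alpha>)) \<partial>?PL) = (\<integral>\<^sup>+y. f (\<Phi> x y) \<partial>?PL)"
        by simp
    qed
    \<comment> \<open>The shear depends on x and is therefore done with x fixed. Now the order
      changes, because the exceptional set is null in x for each fixed y.\<close>
    also have "\<dots> = (\<integral>\<^sup>+y. \<integral>\<^sup>+x. f (\<Phi> x y) \<partial>?PJ \<partial>?PL)"
    proof -
      interpret pair_sigma_finite ?PJ ?PL
        using fin by (intro pair_sigma_finite.intro L.sigma_finite)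
      show ?thesis by (rule Fubini'[symmetric]) measurable
    qed
    also have "\<dots> = (\<integral>\<^sup>+y. 0 \<partial>?PL)"
    proof (rule nn_integral_cong)
      fix y assume y: "y \<in> space ?PL"
      have m1 [measurable]: "(\<lambda>x. f (\<Phi> x y)) \<in> borel_measurable ?PJ"
        using measurable_Pair1[OF hm y] by simp
      have [measurable]: "(\<lambda>x. f (\<Phi> (\<lambda>p\<in>J. 0 + \<alpha> * x p) y)) \<in> borel_measurable ?PJ"
        by measurable
      \<comment> \<open>With x = \<alpha> s the term x_i x_j / \<alpha> becomes \<alpha> s_i s_j, as
        the completed square requires.\<close>
      have "AE s in PiM ((\<lambda>j. {o', j}) ` (UNIV - {o'})) (\<lambda>_. lborel).
         indefinite_int (sym_matrix_of (\<Phi> (\<lambda>p\<in>J. 0 + \<alpha> * s p) y)) \<longrightarrow> small_values \<tau> (sym_matrix_of (\<Phi> (\<lambda>p\<in>J. 0 + \<alpha> * s p) y))"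
      proof (rule AE_small_values[OF n \<alpha> \<eta> \<tau>, where y = "\<lambda>i j. y {i, j}"])
        fix s :: "'n set \<Rightarrow> real" and i j :: 'n
        show "sym_matrix_of (\<Phi> (\<lambda>p\<in>J. 0 + \<alpha> * s p) y) $ o' $ o' = \<alpha>"
          by (simp add: sym_matrix_of_def \<Phi>_def)
        assume j: "j \<noteq> o'"
        then have jJ: "{o', j} \<in> J" by (auto simp: J_def N_def)
        show "sym_matrix_of (\<Phi> (\<lambda>p\<in>J. 0 + \<alpha> * s p) y) $ o' $ j = \<alpha> * s {o', j}"
          using j jJ by (simp add: sym_matrix_of_def \<Phi>_def)
        then show "sym_matrix_of (\<Phi> (\<lambda>p\<in>J. 0 + \<alpha> * s p) y) $ j $ o' = \<alpha> * s {o', j}"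
          by (simp add: sym_matrix_of_def insert_commute)
        assume i: "i \<noteq> o'"
        then have iJ: "{o', i} \<in> J" by (auto simp: J_def N_def)
        have ij: "{i, j} \<in> L" using i j by (auto simp: L_def N_def)
        then have ij2: "{i, j} \<notin> J" "{i, j} \<noteq> {o'}" using disj by auto
        show "sym_matrix_of (\<Phi> (\<lambda>p\<in>J. 0 + \<alpha> * s p) y) $ i $ j = y {i, j} + \<alpha> * s {o', i} * s {o', j}"
          using \<alpha> i j ij ij2 iJ jJ by (simp add: sym_matrix_of_def \<Phi>_def pair_prod)
      qed
      then have "AE s in ?PJ. f (\<Phi> (\<lambda>p\<in>J. 0 + \<alpha> * s p) y) = 0"
        unfolding J_def[symmetric] N_def[symmetric] by eventually_elim (simp add: f_def T_def)
      then have "(\<integral>\<^sup>+s. f (\<Phi> (\<lambda>p\<in>J. 0 + \<alpha> * s p) y) \<partial>?PJ) = 0"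
        by (subst nn_integral_0_iff_AE) auto
      then show "(\<integral>\<^sup>+x. f (\<Phi> x y) \<partial>?PJ) = 0"
        using nn_integral_PiM_lborel_affine[OF fin(1) \<alpha> m1, of "\<lambda>_. 0"] by simp
    qed
    finally show ?thesis by simp
  qed
  have "(\<integral>\<^sup>+a. f a \<partial>PiM (insert {o'} (J \<union> L)) (\<lambda>_. lborel)) =
      (\<integral>\<^sup>+\<alpha>. \<integral>\<^sup>+z. f (z({o'} := \<alpha>)) \<partial>PiM (J \<union> L) (\<lambda>_. lborel) \<partial>lborel)"
    using fin disj by (intro L.product_nn_integral_insert_rev) auto
  \<comment> \<open>The value \<alpha> = 0, where the square cannot be completed, is a single point
    and hence null.\<close>
  also have "\<dots> = (\<integral>\<^sup>+(\<alpha>::real). 0 \<partial>lborel)"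
    by (intro nn_integral_cong_AE eventually_mono[OF AE_lborel_singleton[of 0]]) (rule zero)
  finally have "(\<integral>\<^sup>+a. f a \<partial>PiM (insert {o'} (J \<union> L)) (\<lambda>_. lborel)) = 0"
    by simp
  then have "AE a in PiM (insert {o'} (J \<union> L)) (\<lambda>_. lborel). f a = 0"
    by (subst (asm) nn_integral_0_iff_AE) auto
  then show ?thesis
    unfolding I by eventually_elim (auto simp: f_def T_def indicator_def split: if_splits)
qed

section \<open>Transfer to the space of symmetric matrices\<close>

theorem theorem1p1:
  fixes p q n :: nat and \<delta> :: real
  assumes "p \<ge> 1" and "q \<ge> 1" and "n = p + q" and "n \<ge> 3"
    and "CARD('n::finite) = n" and "\<delta> > 0"
  shows "AE Q in (sym_lebesgue :: (real ^ 'n ^ 'n) measure). has_signature p q Q \<longrightarrow>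
    (\<exists>c > 0. \<exists>\<epsilon>\<^sub>0 > 0. \<forall>\<epsilon>. 0 < \<epsilon> \<and> \<epsilon> < \<epsilon>\<^sub>0 \<longrightarrow>
      (\<exists>x :: real ^ 'n. x \<noteq> 0 \<and> (\<forall>i. x $ i \<in> \<int>) \<and>
        norm x \<le> c * \<epsilon> powr (- (1 / (real n - 2) + \<delta>)) \<and>
        \<bar>quad_form Q x\<bar> < \<epsilon>))"
proof -
  define \<tau> where "\<tau> = 1 / (real n - 2) + \<delta>"
  have \<tau>: "\<tau> > 0" using assms by (auto simp: \<tau>_def intro!: add_nonneg_pos)
  \<comment> \<open>\<open>AE_distr_iff\<close> needs a measurable predicate; this is why the
    push-forward is applied to \<open>indefinite_int\<close> and \<open>small_values\<close>, and
    signature and general \<epsilon> come in only pointwise afterwards.\<close>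
  have "Measurable.pred (restrict_space borel sym_matrices)
      (\<lambda>Q :: real ^ 'n ^ 'n. indefinite_int Q \<longrightarrow> small_values \<tau> Q)"
    by (rule measurable_restrict_space1) measurable
  then have "AE Q in (sym_lebesgue :: (real ^ 'n ^ 'n) measure). indefinite_int Q \<longrightarrow> small_values \<tau> Q"
    unfolding sym_lebesgue_def
    using AE_sym_coordinates_small_values[of \<delta> \<tau>, where 'n='n] assms
    by (subst AE_distr_iff[OF sym_matrix_of_measurable]) (auto simp: \<tau>_def)
  then show ?thesis
  proof eventually_elim
    case (elim Q)
    show ?case
    proof
      assume "has_signature p q Q"
      then have "small_values \<tau> Q"
        using elim has_signature_indefinite_int assms by blast
      from small_values_imp[OF this \<tau>] show "\<exists>c > 0. \<exists>\<epsilon>\<^sub>0 > 0. \<forall>\<epsilon>. 0 < \<epsilon> \<and> \<epsilon> < \<epsilon>\<^sub>0 \<longrightarrow>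
        (\<exists>x :: real ^ 'n. x \<noteq> 0 \<and> (\<forall>i. x $ i \<in> \<int>) \<and>
          norm x \<le> c * \<epsilon> powr (- (1 / (real n - 2) + \<delta>)) \<and> \<bar>quad_form Q x\<bar> < \<epsilon>)"
        unfolding \<tau>_def .
    qed
  qed
qed

end
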